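(* (Prime Orbit Theorem with Error Term.) Let $\mathcal F_{\mathfrak w}$ be a nonlattice self-similar flow with weights $w_1\le\dots\le w_N$ and dimension $D$. (1) Suppose $w_1,\dots,w_N$ are badly approximable, in the sense that $|qw_j-p_jw_1|\gg q^{-1/(N-1)}$ for $j=1,\dots,N$ and every $q\ge1$ ($q$ and the $p_j$ denoting integers). Then $$\psi_{\mathfrak w}(x)=\frac{x^D}{D}+O\left(x^D\left(\frac{\log\log x}{\log x}\right)^{\frac{N-1}{4}}\right)\quad\text{as }x\to\infty.$$ (2) Suppose $w_1,\dots,w_N$ is polynomially approximable, in the sense that $|qw_j-p_jw_1|\ge\frac{w_1}{a(q)}q^{-1/(N-1)}$ for $j=1,\dots,N$ and every $q\ge1$ ($q$ and the $p_j$ denoting integers), for some increasing function $a$ on $[1,\infty)$ such that $a(x)=O(x^l)$ as $x\to\infty$. Then $$\psi_{\mathfrak w}(x)=\frac{x^D}{D}+O\left(x^D\left(\frac{\log\log x}{\log x}\right)^{\frac{N-1}{4l(N-1)+4}}\right)\quad\text{as }x\to\infty.$$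
   Context: Self-similar flow: $N\ge2$, $\Omega=\{1,\dots,N\}^{\mathbb N}$ with left shift $\sigma$, and a weight function $\mathfrak w:\Omega\to(0,\infty)$ depending only on the first letter: $\mathfrak w(a)=w_{a_1}$, where $0<w_1\le\dots\le w_N$. The flow is nonlattice if the subgroup $\sum_{j=1}^N\mathbb Zw_j$ is dense in $\mathbb R$, i.e. at least one ratio $w_j/w_k$ is irrational. The dimension $D>0$ of the flow is the unique real solution of $\sum_{j=1}^Ne^{-w_js}=1$. For a periodic orbit $\mathfrak p$ of $\sigma$ (a finite set $\{a,\sigma a,\dots\}\subset\Omega$), put $\mathfrak w_t(\mathfrak p)=\sum_{a\in\mathfrak p}\mathfrak w(a)$. The counting function is $$\psi_{\mathfrak w}(x)=\sum_{k\mathfrak w_t(\mathfrak p)\le\log x}\mathfrak w_t(\mathfrak p),$$ the sum over all pairs of a periodic orbit $\mathfrak p$ and an integer $k\ge1$ with $k\mathfrak w_t(\mathfrak p)\le\log x$. The function $a$ takes positive real values. The notation $A\gg B$ means $A\ge cB$ for some constant $c>0$. *)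

theory Defs
  imports "HOL-Analysis.Analysis" "HOL-Library.Landau_Symbols"
begin

section \<open>Suspended flows over the full shift\<close>

text \<open>Words are indexed from 0, so the first letter of a word \<open>a\<close> is \<open>a 0\<close>;
  letters and weights are indexed from 1 to \<open>N\<close>.\<close>

definition words :: "nat \<Rightarrow> (nat \<Rightarrow> nat) set" where
  "words N = (UNIV \<rightarrow> {1..N})"

definition shift :: "(nat \<Rightarrow> nat) \<Rightarrow> nat \<Rightarrow> nat" where
  "shift a = (\<lambda>n. a (Suc n))"

definition periodic_orbits :: "nat \<Rightarrow> (nat \<Rightarrow> nat) set set" where
  "periodic_orbits N =
     {range (\<lambda>n. (shift ^^ n) a) |a. a \<in> words N \<and> (\<exists>m\<ge>1. (shift ^^ m) a = a)}"

definition total_weight :: "((nat \<Rightarrow> nat) \<Rightarrow> real) \<Rightarrow> (nat \<Rightarrow> nat) set \<Rightarrow> real" where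
  "total_weight W p = (\<Sum>a\<in>p. W a)"

text \<open>The index set is finite for self-similar flows, see \<open>finite_counting_index\<close> below.\<close>

definition counting_function :: "nat \<Rightarrow> ((nat \<Rightarrow> nat) \<Rightarrow> real) \<Rightarrow> real \<Rightarrow> real" where
  "counting_function N W x =
     (\<Sum>(p, k) \<in> {(p, k :: nat). p \<in> periodic_orbits N \<and> k \<ge> 1 \<and> real k * total_weight W p \<le> ln x}.
        total_weight W p)"

section \<open>Self-similar flows\<close>

definition self_similar_weight :: "(nat \<Rightarrow> real) \<Rightarrow> (nat \<Rightarrow> nat) \<Rightarrow> real" where
  "self_similar_weight w a = w (a 0)"

definition self_similar_flow :: "nat \<Rightarrow> (nat \<Rightarrow> real) \<Rightarrow> bool" where
  "self_similar_flow N w \<longleftrightarrow> N \<ge> 2 \<and> 0 < w 1 \<and> mono_on {1..N} w"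

definition nonlattice :: "nat \<Rightarrow> (nat \<Rightarrow> real) \<Rightarrow> bool" where
  "nonlattice N w \<longleftrightarrow>
     closure (range (\<lambda>m :: nat \<Rightarrow> int. \<Sum>j=1..N. of_int (m j) * w j)) = (UNIV :: real set)"

definition flow_dimension :: "nat \<Rightarrow> (nat \<Rightarrow> real) \<Rightarrow> real" where
  "flow_dimension N w = (THE s. (\<Sum>j=1..N. exp (- w j * s)) = 1)"

text \<open>
  Both conditions concern simultaneous Diophantine approximation of \<open>w 1, \<dots>, w N\<close> with a common
  denominator \<open>q\<close>: they say that no \<open>q\<close> and \<open>p\<close> make all of the quantities
  \<open>\<bar>q * w j - p j * w 1\<bar>\<close> small at once, i.e. that their maximum over \<open>j\<close> is bounded below.
  (A lower bound for each \<open>j\<close> separately is impossible: the quantity vanishes for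
  \<open>j = 1\<close> and \<open>p 1 = q\<close>, and for \<open>N \<ge> 3\<close> the exponent \<open>1 / (N - 1)\<close> would contradict
  Dirichlet's theorem for every other \<open>j\<close>.)
\<close>

definition badly_approximable :: "nat \<Rightarrow> (nat \<Rightarrow> real) \<Rightarrow> bool" where
  "badly_approximable N w \<longleftrightarrow>
     (\<exists>c>0. \<forall>q::int. \<forall>p :: nat \<Rightarrow> int. q \<ge> 1 \<longrightarrow>
        (\<exists>j\<in>{1..N}. \<bar>of_int q * w j - of_int (p j) * w 1\<bar> \<ge> c * of_int q powr (- 1 / (real N - 1))))"

definition polynomially_approximable :: "nat \<Rightarrow> (nat \<Rightarrow> real) \<Rightarrow> real \<Rightarrow> bool" where
  "polynomially_approximable N w l \<longleftrightarrow>
     (\<exists>a :: real \<Rightarrow> real.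
        (\<forall>x\<ge>1. a x > 0) \<and> mono_on {1..} a \<and> a \<in> O(\<lambda>x. x powr l) \<and>
        (\<forall>q::int. \<forall>p :: nat \<Rightarrow> int. q \<ge> 1 \<longrightarrow>
           (\<exists>j\<in>{1..N}. \<bar>of_int q * w j - of_int (p j) * w 1\<bar>
              \<ge> w 1 / a (of_int q) * of_int q powr (- 1 / (real N - 1)))))"

section \<open>Well-definedness\<close>

lemma self_similar_flow_pos:
  assumes "self_similar_flow N w" "j \<in> {1..N}"
  shows "w 1 \<le> w j" "0 < w j"
proof -
  show "w 1 \<le> w j"
    using assms unfolding self_similar_flow_def by (intro mono_onD[of "{1..N}" w 1 j]) auto
  thus "0 < w j" using assms unfolding self_similar_flow_def by auto
qed

lemma flow_dimension_ex1:
  assumes "self_similar_flow N w"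
  shows "\<exists>!s. (\<Sum>j=1..N. exp (- w j * s)) = 1"
    and "\<And>s. (\<Sum>j=1..N. exp (- w j * s)) = 1 \<Longrightarrow> 0 < s"
proof -
  define f where "f s = (\<Sum>j=1..N. exp (- w j * s))" for s
  have N: "N \<ge> 2" and w1: "0 < w 1" using assms by (auto simp: self_similar_flow_def)
  have anti: "f t < f s" if "s < t" for s t
    unfolding f_def
    by (rule sum_strict_mono) (use N that self_similar_flow_pos[OF assms] in auto)
  have f0: "f 0 > 1" using N by (simp add: f_def)
  define B where "B = ln (real N) / w 1"
  have B0: "B \<ge> 0" using N w1 by (simp add: B_def)
  have "f B \<le> (\<Sum>j=1..N. exp (- w 1 * B))"
    unfolding f_def
    by (rule sum_mono) (use B0 self_similar_flow_pos[OF assms] in \<open>auto intro!: mult_right_mono\<close>)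
  also have "\<dots> = 1" using N w1 by (simp add: B_def exp_minus)
  finally have "f B \<le> 1" .
  moreover have "continuous_on {0..B} f" unfolding f_def by (intro continuous_intros)
  ultimately obtain s where "f s = 1" using IVT2'[of f B 1 0] f0 B0 by auto
  moreover have "t = s" if "f t = 1" for t
    using anti[of s t] anti[of t s] that \<open>f s = 1\<close> by (cases s t rule: linorder_cases) auto
  ultimately show "\<exists>!s. (\<Sum>j=1..N. exp (- w j * s)) = 1" unfolding f_def by blast
  show "0 < s" if "(\<Sum>j=1..N. exp (- w j * s)) = 1" for s
    using anti[of s 0] f0 that unfolding f_def by (cases s "0::real" rule: linorder_cases) auto
qed

lemma shift_funpow: "(shift ^^ m) a = (\<lambda>n. a (n + m))"
  by (induction m arbitrary: a) (auto simp: shift_def funpow_swap1)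

lemma finite_periodic_words:
  assumes "m \<ge> 1"
  shows "finite {a \<in> words N. (shift ^^ m) a = a}"
proof (rule finite_imageD)
  let ?A = "{a \<in> words N. (shift ^^ m) a = a}"
  have "(\<lambda>a. restrict a {..<m}) ` ?A \<subseteq> ({..<m} \<rightarrow>\<^sub>E {1..N})" by (auto simp: words_def PiE_def Pi_def)
  thus "finite ((\<lambda>a. restrict a {..<m}) ` ?A)"
    by (rule finite_subset) (auto intro!: finite_PiE)
  show "inj_on (\<lambda>a. restrict a {..<m}) ?A"
  proof (rule inj_onI)
    fix a b assume a: "a \<in> ?A" and b: "b \<in> ?A" and eq: "restrict a {..<m} = restrict b {..<m}"
    have per: "c (n + m) = c n" if "c \<in> ?A" for c n
      using that by (auto simp: shift_funpow dest: fun_cong)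
    show "a = b"
    proof
      fix n show "a n = b n"
      proof (induction n rule: less_induct)
        case (less n)
        show ?case
        proof (cases "n < m")
          case True thus ?thesis using fun_cong[OF eq, of n] by simp
        next
          case False
          thus ?thesis using less[of "n - m"] per[OF a, of "n - m"] per[OF b, of "n - m"] assms by simp
        qed
      qed
    qed
  qed
qed

lemma periodic_orbit_properties:
  assumes "p \<in> periodic_orbits N"
  shows "finite p" "p \<noteq> {}" "\<exists>a \<in> words N. (shift ^^ card p) a = a \<and> p = range (\<lambda>n. (shift ^^ n) a)"
    "p \<subseteq> words N"
proof -
  obtain a where p: "p = range (\<lambda>n. (shift ^^ n) a)" and a: "a \<in> words N"
    and ex: "\<exists>m\<ge>1. (shift ^^ m) a = a"
    using assms by (auto simp: periodic_orbits_def)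
  define m where "m = (LEAST m. m \<ge> 1 \<and> (shift ^^ m) a = a)"
  have m: "m \<ge> 1" "(shift ^^ m) a = a"
    using LeastI_ex[OF ex[unfolded Bex_def]] by (auto simp: m_def)
  have least: "m \<le> k" if "k \<ge> 1" "(shift ^^ k) a = a" for k
    unfolding m_def by (rule Least_le) (use that in auto)
  have modm: "(shift ^^ n) a = (shift ^^ (n mod m)) a" for n
    using m(2) by (simp add: funpow_mod_eq)
  have p': "p = (\<lambda>n. (shift ^^ n) a) ` {..<m}"
    using modm m(1) unfolding p by (auto simp: image_iff) (metis mod_less_divisor lessThan_iff less_eq_Suc_le One_nat_def)
  have neq: False if "i < j" "j < m" "(shift ^^ i) a = (shift ^^ j) a" for i j
  proof -
    have "(shift ^^ (m - j)) ((shift ^^ i) a) = (shift ^^ (m - j)) ((shift ^^ j) a)" using that by simp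
    hence "(shift ^^ (m - j + i)) a = (shift ^^ (m - j + j)) a" by (simp only: funpow_add o_apply)
    hence "(shift ^^ (m - j + i)) a = a" using that m by simp
    with least[of "m - j + i"] that show False by linarith
  qed
  have "inj_on (\<lambda>n. (shift ^^ n) a) {..<m}"
    by (rule inj_onI) (metis neq lessThan_iff linorder_neqE_nat)
  hence "card p = m" by (simp add: p' card_image)
  thus "\<exists>a \<in> words N. (shift ^^ card p) a = a \<and> p = range (\<lambda>n. (shift ^^ n) a)"
    using a p m by auto
  show "finite p" "p \<noteq> {}" using p' p by auto
  show "p \<subseteq> words N" using a unfolding p by (auto simp: words_def shift_funpow)
qed

lemma finite_counting_index:
  assumes "self_similar_flow N w"
  defines "W \<equiv> self_similar_weight w"
  shows "finite {(p, k :: nat). p \<in> periodic_orbits N \<and> k \<ge> 1 \<and> real k * total_weight W p \<le> y}"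
proof -
  have w1: "0 < w 1" using assms by (auto simp: self_similar_flow_def)
  define M where "M = nat \<lceil>y / w 1\<rceil>"
  define P where "P = (\<lambda>a. range (\<lambda>n. (shift ^^ n) a)) ` (\<Union>m\<in>{1..M}. {a \<in> words N. (shift ^^ m) a = a})"
  have "finite P" unfolding P_def by (intro finite_imageI finite_UN_I finite_periodic_words) auto
  have "p \<in> P \<and> k \<le> M" if p: "p \<in> periodic_orbits N" and k: "k \<ge> 1"
    and le: "real k * total_weight W p \<le> y" for p k
  proof -
    note pp = periodic_orbit_properties[OF p]
    have c: "card p \<ge> 1" using pp(1,2) by (simp add: Suc_leI card_gt_0_iff)
    have "(\<Sum>a\<in>p. w 1) \<le> total_weight W p"
      unfolding total_weight_def
      unfolding W_def self_similar_weight_def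
      by (intro sum_mono self_similar_flow_pos(1)[OF assms(1)])
         (use pp(4) in \<open>auto simp: words_def Pi_def\<close>)
    hence "real k * (real (card p) * w 1) \<le> y"
      using le by (intro order_trans[OF mult_left_mono le]) auto
    hence "real (k * card p) \<le> y / w 1" using w1 by (simp add: field_simps)
    hence kc: "k * card p \<le> M" unfolding M_def by linarith
    have "card p \<le> k * card p" "k \<le> k * card p" using k c by auto
    hence "card p \<le> M" "k \<le> M" using kc by linarith+
    obtain a where "a \<in> words N" "(shift ^^ card p) a = a" "p = range (\<lambda>n. (shift ^^ n) a)"
      using pp(3) by blast
    moreover have "card p \<in> {1..M}" using c \<open>card p \<le> M\<close> by simp
    ultimately have "p \<in> P" unfolding P_def by (intro image_eqI[of _ _ a] UN_I[of "card p"]) auto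
    with \<open>k \<le> M\<close> show ?thesis by simp
  qed
  hence "{(p, k :: nat). p \<in> periodic_orbits N \<and> k \<ge> 1 \<and> real k * total_weight W p \<le> y} \<subseteq> P \<times> {..M}"
    by auto
  thus ?thesis by (rule finite_subset) (simp add: \<open>finite P\<close>)
qed

end

theory Submission
  imports Defs
begin

text \<open>Write \<open>y = ln x\<close>. A pair of a periodic orbit and a multiplicity, together with a point of the
  orbit, is the same thing as a nonempty finite word: repeat the word periodically. Hence
  \<open>\<psi>(x) = \<Sum>\<^sub>j w\<^sub>j R(y - w\<^sub>j)\<close>, where \<open>R(y)\<close> is the number of finite words of weight at most \<open>y\<close>
  (\<open>counting_function_eq_word_count\<close>). Splitting off the first letter gives
  \<open>R(y) = 1 + \<Sum>\<^sub>j R(y - w\<^sub>j)\<close> for \<open>y \<ge> 0\<close>. With the probabilities \<open>p\<^sub>j = e\<^bsup>-Dw\<^sub>j\<^esup>\<close> the tilted function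
  \<open>A(y) = e\<^bsup>-Dy\<^esup> R(y)\<close> satisfies the renewal equation \<open>A = PA + e\<^bsup>-Dy\<^esup>\<close> on the half line, where
  \<open>P f(y) = \<Sum>\<^sub>j p\<^sub>j f(y - w\<^sub>j)\<close>. So the theorem is a renewal theorem with a rate:
  \<open>A\<close> tends to \<open>1/(D\<mu>)\<close> with \<open>\<mu> = \<Sum>\<^sub>j p\<^sub>j w\<^sub>j\<close>, and the speed depends on how well the \<open>w\<^sub>j\<close> can be
  approximated by multiples of a common number.

  The rate is obtained without contour integration. Let \<open>a\<close> be the error \<open>A - 1/(D\<mu>)\<close> on the half
  line. Two averages nearly reproduce or annihilate \<open>a\<close>, up to exponentially small errors: \<open>Pa \<approx> a\<close> by
  the renewal equation, and \<open>Qa \<approx> 0\<close> for the mean \<open>Q\<close> over the residual (integrated tail)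
  distribution, because \<open>QA\<close> can be computed exactly. Consequently
  \<open>a \<approx> (1 - Q)\<^sup>k ((1 + P)/2)\<^sup>n a\<close> for fixed \<open>k\<close> and for \<open>n\<close> proportional to \<open>y\<close>. On the
  frequency \<open>t\<close> the operators act by multiplication with \<open>(1 - \<rho>(t))\<^sup>k ((1 + \<phi>(t))/2)\<^sup>n\<close>. Since
  \<open>\<bar>(1 + \<phi>)/2\<bar>\<^sup>2 \<le> exp (- (1 - Re \<phi>)/2)\<close> and \<open>1 - \<rho>(t) = O(t)\<close>, for suitable
  \<open>k\<close> this product is below any prescribed negative power of \<open>y\<close>
  for all \<open>\<bar>t\<bar> \<le> T\<close> as soon as \<open>1 - Re \<phi>(t) \<ge> c min(t\<^sup>2, t\<^bsup>-\<kappa>\<^esup>)\<close> and \<open>T\<^sup>\<kappa>\<close> is a small multiple of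
  \<open>y / ln y\<close>. Thus the average of \<open>a\<close> against a Fejer kernel, whose frequencies lie in \<open>[-T, T]\<close>, is
  negligible. The function \<open>e\<^bsup>Dy\<^esup> A(y)\<close> is increasing and the Fejer kernel has mass \<open>O(1/(T\<eta>))\<close> outside
  \<open>[-\<eta>, \<eta>]\<close>, so removing the average costs \<open>O(\<eta> + 1/(T\<eta>))\<close>. The choice \<open>\<eta> = T\<^bsup>-1/2\<^esup>\<close> gives
  \<open>a(y) = O((ln y / y)\<^bsup>1/(2\<kappa>)\<^esup>)\<close> (\<open>renewal_rate\<close>).

  The Diophantine hypothesis enters only through \<open>1 - Re \<phi>(t) = \<Sum>\<^sub>j p\<^sub>j (1 - cos (t w\<^sub>j))\<close>, which
  is comparable to the square of the largest distance of \<open>t w\<^sub>j / 2\<pi>\<close> to an integer. If this distance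
  is \<open>\<delta>\<close>, the integers nearest to \<open>t w\<^sub>j / 2\<pi>\<close> give a simultaneous approximation of the \<open>w\<^sub>j / w\<^sub>1\<close> with
  denominator of order \<open>t\<close> and error of order \<open>\<delta>\<close> over that denominator, whence
  \<open>\<kappa> = 2 (l + 1/(N - 1))\<close> (\<open>cosine_sum_lower_bound\<close>).\<close>

section \<open>Counting words by weight\<close>

definition word_weight :: "(nat \<Rightarrow> real) \<Rightarrow> nat list \<Rightarrow> real" where
  "word_weight w u = sum_list (map w u)"

definition word_count :: "nat \<Rightarrow> (nat \<Rightarrow> real) \<Rightarrow> real \<Rightarrow> nat" where
  "word_count N w y = card {u \<in> lists {1..N}. word_weight w u \<le> y}"

lemma length_mult_le_word_weight:
  assumes "self_similar_flow N w" "u \<in> lists {1..N}"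
  shows "real (length u) * w 1 \<le> word_weight w u"
  using assms(2)
proof induction
  case (Cons j u)
  then show ?case
    using self_similar_flow_pos(1)[OF assms(1), of j] by (simp add: word_weight_def algebra_simps)
qed (simp add: word_weight_def)

lemma finite_words_le:
  assumes "self_similar_flow N w"
  shows "finite {u \<in> lists {1..N}. word_weight w u \<le> y}"
proof (rule finite_subset)
  have w1: "0 < w 1" using assms by (auto simp: self_similar_flow_def)
  show "{u \<in> lists {1..N}. word_weight w u \<le> y} \<subseteq> {u. set u \<subseteq> {1..N} \<and> length u \<le> nat \<lceil>y / w 1\<rceil>}"
  proof
    fix u assume "u \<in> {u \<in> lists {1..N}. word_weight w u \<le> y}"
    then have u: "u \<in> lists {1..N}" "word_weight w u \<le> y" by auto
    have "real (length u) \<le> y / w 1"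
      using length_mult_le_word_weight[OF assms u(1)] u(2) w1 by (simp add: field_simps)
    then have "length u \<le> nat \<lceil>y / w 1\<rceil>" by linarith
    then show "u \<in> {u. set u \<subseteq> {1..N} \<and> length u \<le> nat \<lceil>y / w 1\<rceil>}"
      using u(1) by (simp add: in_lists_conv_set subset_iff)
  qed
  show "finite {u. set u \<subseteq> {1..N} \<and> length u \<le> nat \<lceil>y / w 1\<rceil>}"
    by (intro finite_lists_length_le) auto
qed

lemma word_count_neg:
  assumes "self_similar_flow N w" "y < 0"
  shows "word_count N w y = 0"
proof -
  have "0 < w 1" using assms by (auto simp: self_similar_flow_def)
  then have "word_weight w u \<ge> 0" if "u \<in> lists {1..N}" for u
    using length_mult_le_word_weight[OF assms(1) that]
    by (meson dual_order.trans less_imp_le mult_nonneg_nonneg of_nat_0_le_iff)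
  then have "{u \<in> lists {1..N}. word_weight w u \<le> y} = {}" using assms(2) by fastforce
  then show ?thesis unfolding word_count_def by (simp only: card.empty)
qed

lemma sum_hd_words:
  fixes g :: "nat \<Rightarrow> real"
  assumes "self_similar_flow N w"
  shows "(\<Sum>u\<in>{u \<in> lists {1..N}. u \<noteq> [] \<and> word_weight w u \<le> y}. g (hd u))
       = (\<Sum>j=1..N. g j * real (word_count N w (y - w j)))"
proof -
  let ?S = "Sigma {1..N} (\<lambda>j. {u \<in> lists {1..N}. word_weight w u \<le> y - w j})"
  have "(\<Sum>u\<in>{u \<in> lists {1..N}. u \<noteq> [] \<and> word_weight w u \<le> y}. g (hd u)) = (\<Sum>z\<in>?S. g (fst z))"
    by (rule sum.reindex_bij_witness[of _ "\<lambda>z. fst z # snd z" "\<lambda>u. (hd u, tl u)"])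
       (auto simp: word_weight_def neq_Nil_conv)
  also have "\<dots> = (\<Sum>j=1..N. \<Sum>u\<in>{u \<in> lists {1..N}. word_weight w u \<le> y - w j}. g j)"
    by (subst sum.Sigma) (simp_all add: finite_words_le[OF assms] split_def del: One_nat_def)
  also have "\<dots> = (\<Sum>j=1..N. g j * real (word_count N w (y - w j)))"
    by (simp add: word_count_def mult.commute)
  finally show ?thesis .
qed

text \<open>Splitting off the first letter.\<close>

lemma word_count_rec:
  assumes "self_similar_flow N w" "0 \<le> y"
  shows "real (word_count N w y) = 1 + (\<Sum>j=1..N. real (word_count N w (y - w j)))"
proof -
  have "{u \<in> lists {1..N}. word_weight w u \<le> y} =
      insert [] {u \<in> lists {1..N}. u \<noteq> [] \<and> word_weight w u \<le> y}"
    using assms(2) by (auto simp: word_weight_def)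
  moreover have "finite {u \<in> lists {1..N}. u \<noteq> [] \<and> word_weight w u \<le> y}"
    by (rule finite_subset[OF _ finite_words_le[OF assms(1), of y]]) auto
  ultimately have "real (word_count N w y)
      = 1 + real (card {u \<in> lists {1..N}. u \<noteq> [] \<and> word_weight w u \<le> y})"
    by (simp add: word_count_def)
  also have "real (card {u \<in> lists {1..N}. u \<noteq> [] \<and> word_weight w u \<le> y})
      = (\<Sum>j=1..N. real (word_count N w (y - w j)))"
    using sum_hd_words[OF assms(1), of "\<lambda>_. 1" y] by simp
  finally show ?thesis .
qed

lemma word_count_mono:
  assumes "self_similar_flow N w" "y \<le> z"
  shows "word_count N w y \<le> word_count N w z"
  unfolding word_count_def
  by (rule card_mono[OF finite_words_le[OF assms(1)]]) (use assms(2) in auto)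

text \<open>The right side without \<open>- 1\<close> solves the recursion with its term 1 dropped. Subtracting 1 from it lowers
  the sum over the \<open>N \<ge> 2\<close> letters by \<open>N\<close> and so leaves room for that term; the shift by \<open>w N\<close>
  keeps the bound nonnegative at the negative arguments \<open>y - w j\<close>.\<close>

lemma word_count_bound:
  assumes flow: "self_similar_flow N w" and D: "(\<Sum>j=1..N. exp (- w j * D)) = 1"
    and y: "- w N \<le> y"
  shows "real (word_count N w y) \<le> exp (D * (y + w N)) - 1"
proof -
  have N: "N \<ge> 2" and w1: "0 < w 1" using flow by (auto simp: self_similar_flow_def)
  have Dpos: "0 < D" using flow_dimension_ex1(2)[OF flow D] .
  have wN: "w j \<le> w N" if "j \<in> {1..N}" for j
    using flow that unfolding self_similar_flow_def by (intro mono_onD[of "{1..N}" w]) auto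
  have "real (word_count N w y) \<le> exp (D * (y + w N)) - 1"
    if "y < real n * w 1" "- w N \<le> y" for n y
    using that
  proof (induction n arbitrary: y)
    case 0
    then show ?case using word_count_neg[OF flow] Dpos by simp
  next
    case (Suc n)
    show ?case
    proof (cases "y < 0")
      case True
      then show ?thesis using Suc.prems word_count_neg[OF flow] Dpos by simp
    next
      case False
      have "real (word_count N w y) = 1 + (\<Sum>j=1..N. real (word_count N w (y - w j)))"
        using False word_count_rec[OF flow] by simp
      also have "(\<Sum>j=1..N. real (word_count N w (y - w j)))
          \<le> (\<Sum>j=1..N. exp (- w j * D) * exp (D * (y + w N)) - 1)"
      proof (rule sum_mono)
        fix j assume j: "j \<in> {1..N}"
        have "w 1 \<le> w j" using self_similar_flow_pos[OF flow j] by simp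
        then have "real (word_count N w (y - w j)) \<le> exp (D * (y - w j + w N)) - 1"
          using Suc.prems False wN[OF j] by (intro Suc.IH) (auto simp: algebra_simps)
        then show "real (word_count N w (y - w j)) \<le> exp (- w j * D) * exp (D * (y + w N)) - 1"
          by (simp add: exp_add[symmetric] algebra_simps)
      qed
      also have "\<dots> = exp (D * (y + w N)) - real N"
        using D by (simp add: sum_subtractf sum_distrib_right[symmetric])
      finally show ?thesis using N by linarith
    qed
  qed
  moreover obtain n :: nat where "y < real n * w 1" using reals_Archimedean3[OF w1] by blast
  ultimately show ?thesis using y by blast
qed

section \<open>Periodic orbits and words\<close>

abbreviation orbit :: "(nat \<Rightarrow> nat) \<Rightarrow> (nat \<Rightarrow> nat) set" where
  "orbit a \<equiv> range (\<lambda>n. (shift ^^ n) a)"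

lemma periodic_orbit_point:
  assumes p: "p \<in> periodic_orbits N" and b: "b \<in> p"
  shows "orbit b = p" "(shift ^^ card p) b = b" "bij_betw (\<lambda>n. (shift ^^ n) b) {..<card p} p"
    "card p \<ge> 1"
proof -
  obtain a where a: "(shift ^^ card p) a = a" "p = orbit a"
    using periodic_orbit_properties(3)[OF p] by blast
  have c: "card p \<ge> 1" using periodic_orbit_properties(1,2)[OF p] by (simp add: Suc_leI card_gt_0_iff)
  obtain i where i: "b = (shift ^^ i) a" using b a(2) by auto
  have mult: "(shift ^^ (i * card p)) a = a" using a(1) funpow_mod_eq[of "card p" shift a "i * card p"] by simp
  have a': "a (n + card p) = a n" "a (n + i * card p) = a n" for n
    using fun_cong[OF a(1), of n] fun_cong[OF mult, of n] by (simp_all add: shift_funpow)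
  have b': "b n = a (n + i)" for n by (simp add: i shift_funpow)
  have "(shift ^^ n) b = (shift ^^ (n + i)) a" for n by (simp add: b' shift_funpow add.assoc)
  then have "orbit b \<subseteq> p" using a(2) by auto
  moreover have "\<exists>k. (shift ^^ n) a = (shift ^^ k) b" for n
  proof -
    have "i \<le> i * card p" using c by simp
    then obtain d where d: "i * card p = d + i" by (metis le_iff_add add.commute)
    have "b (m + (n + d)) = a (m + n)" for m
      using a'(2)[of "m + n"] by (simp add: b' d add.assoc)
    then show ?thesis by (intro exI[of _ "n + d"]) (simp add: shift_funpow)
  qed
  then have "p \<subseteq> orbit b" using a(2) by blast
  ultimately show orb: "orbit b = p" by auto
  have "b (n + card p) = b n" for n using a'(1)[of "n + i"] by (simp add: b' algebra_simps)
  then show per: "(shift ^^ card p) b = b" by (simp add: shift_funpow)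
  have "p = (\<lambda>n. (shift ^^ n) b) ` {..<card p}"
  proof
    show "p \<subseteq> (\<lambda>n. (shift ^^ n) b) ` {..<card p}"
    proof
      fix x assume "x \<in> p"
      then obtain n where "x = (shift ^^ n) b" using orb by auto
      then have "x = (shift ^^ (n mod card p)) b" using funpow_mod_eq[OF per] by simp
      then show "x \<in> (\<lambda>n. (shift ^^ n) b) ` {..<card p}" using c by auto
    qed
  qed (use orb in auto)
  then show "bij_betw (\<lambda>n. (shift ^^ n) b) {..<card p} p"
    unfolding bij_betw_def by (metis card_lessThan eq_card_imp_inj_on finite_lessThan)
  show "card p \<ge> 1" by (fact c)
qed

text \<open>A word that repeats to a point of an orbit \<open>p\<close> has length \<open>k * card p\<close>, which recovers the
  multiplicity \<open>k\<close>.\<close>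

lemma card_orbit_dvd_period:
  assumes p: "p \<in> periodic_orbits N" and b: "b \<in> p" and m: "(shift ^^ m) b = b"
  shows "card p dvd m"
proof -
  note pb = periodic_orbit_point[OF p b]
  have "(shift ^^ (m mod card p)) b = (shift ^^ 0) b" using funpow_mod_eq[OF pb(2)] m by simp
  then have "m mod card p = 0"
    using pb(3,4) unfolding bij_betw_def inj_on_def by (auto simp: dest!: bspec[of _ _ "m mod card p"])
  then show ?thesis by auto
qed

lemma word_weight_map_upt: "word_weight w (map b [0..<n]) = (\<Sum>i<n. w (b i))"
  by (simp add: word_weight_def interv_sum_list_conv_sum_set_nat atLeast0LessThan comp_def)

lemma word_weight_periodic_orbit:
  assumes p: "p \<in> periodic_orbits N" and b: "b \<in> p"
  shows "word_weight w (map b [0..<k * card p]) = real k * total_weight (self_similar_weight w) p"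
proof -
  note pb = periodic_orbit_point[OF p b]
  have per: "b (i + k * card p) = b i" for i k
  proof -
    have "(shift ^^ (k * card p)) b = b" using pb(2) funpow_mod_eq[of "card p" shift b "k * card p"] by simp
    then show ?thesis by (simp add: shift_funpow fun_eq_iff)
  qed
  have "(\<Sum>i<k * card p. w (b i)) = real k * (\<Sum>i<card p. w (b i))"
  proof (induction k)
    case (Suc k)
    have "(\<Sum>i<Suc k * card p. w (b i)) = (\<Sum>i<k * card p. w (b i)) + (\<Sum>i<card p. w (b (i + k * card p)))"
      using sum.nat_group[of "\<lambda>i. w (b i)" "card p" "Suc k"] sum.nat_group[of "\<lambda>i. w (b i)" "card p" k]
        sum.shift_bounds_nat_ivl[of "\<lambda>i. w (b i)" 0 "k * card p" "card p"]
      by (simp add: atLeast0LessThan add.commute)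
    then show ?case using Suc per by (simp add: algebra_simps)
  qed simp
  also have "(\<Sum>i<card p. w (b i)) = total_weight (self_similar_weight w) p"
    unfolding total_weight_def sum.reindex_bij_betw[OF pb(3), symmetric]
    by (simp add: self_similar_weight_def shift_funpow)
  finally show ?thesis by (simp add: word_weight_map_upt)
qed

definition cyclic_word :: "nat list \<Rightarrow> nat \<Rightarrow> nat" where
  "cyclic_word u = (\<lambda>n. u ! (n mod length u))"

lemma cyclic_word:
  assumes u: "u \<in> lists {1..N}" "u \<noteq> []"
  shows "(shift ^^ length u) (cyclic_word u) = cyclic_word u"
    and "orbit (cyclic_word u) \<in> periodic_orbits N"
    and "map (cyclic_word u) [0..<length u] = u"
proof -
  show per: "(shift ^^ length u) (cyclic_word u) = cyclic_word u"
    by (simp add: shift_funpow cyclic_word_def)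
  have "length u \<ge> 1" using u(2) by (simp add: Suc_leI)
  moreover have "cyclic_word u \<in> words N"
  proof -
    have "u ! (n mod length u) \<in> set u" for n using u(2) by simp
    then show ?thesis using u(1) by (fastforce simp: words_def cyclic_word_def in_lists_conv_set)
  qed
  ultimately show "orbit (cyclic_word u) \<in> periodic_orbits N"
    using per unfolding periodic_orbits_def by blast
  show "map (cyclic_word u) [0..<length u] = u"
    by (rule nth_equalityI) (auto simp: cyclic_word_def)
qed

lemma cyclic_word_map_upt:
  assumes "(shift ^^ m) a = a" "m \<ge> 1"
  shows "cyclic_word (map a [0..<m]) = a"
proof
  fix n
  have "a (n mod m) = (shift ^^ (n mod m)) a 0" by (simp add: shift_funpow)
  also have "\<dots> = (shift ^^ n) a 0" using funpow_mod_eq[OF assms(1)] by simp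
  finally show "cyclic_word (map a [0..<m]) n = a n"
    using assms(2) by (simp add: cyclic_word_def shift_funpow)
qed

text \<open>Each weight of an orbit is the sum of \<open>w (a 0)\<close> over its points \<open>a\<close>. The triples \<open>(p, k, a)\<close> with
  \<open>a \<in> p\<close> correspond to nonempty words: the first \<open>k * card p\<close> letters of \<open>a\<close> form a word of weight \<open>k\<close>
  times the weight of \<open>p\<close> whose periodic repetition is \<open>a\<close>. It remains to sum over the first letter.\<close>

theorem counting_function_eq_word_count:
  assumes flow: "self_similar_flow N w"
  shows "counting_function N (self_similar_weight w) x
       = (\<Sum>j=1..N. w j * real (word_count N w (ln x - w j)))"
proof -
  let ?W = "self_similar_weight w"
  define S where "S = {(p, k :: nat). p \<in> periodic_orbits N \<and> k \<ge> 1 \<and> real k * total_weight ?W p \<le> ln x}"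
  have finS: "finite S" unfolding S_def by (rule finite_counting_index[OF flow])
  have "counting_function N ?W x = (\<Sum>z\<in>S. \<Sum>a\<in>fst z. w (a 0))"
    unfolding counting_function_def S_def[symmetric]
    by (simp add: total_weight_def self_similar_weight_def split_def)
  also have "\<dots> = (\<Sum>z\<in>Sigma S fst. w (snd z 0))"
    by (subst sum.Sigma) (use finS in \<open>auto simp: S_def periodic_orbit_properties(1) split_def\<close>)
  also have "\<dots> = (\<Sum>u\<in>{u \<in> lists {1..N}. u \<noteq> [] \<and> word_weight w u \<le> ln x}. w (hd u))"
  proof (rule sum.reindex_bij_witness[of _
        "\<lambda>u. ((orbit (cyclic_word u), length u div card (orbit (cyclic_word u))), cyclic_word u)"
        "\<lambda>z. map (snd z) [0..<snd (fst z) * card (fst (fst z))]"])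
    fix z assume "z \<in> Sigma S fst"
    then obtain p k a where z: "z = ((p, k), a)" and p: "p \<in> periodic_orbits N" "k \<ge> 1"
      "real k * total_weight ?W p \<le> ln x" and a: "a \<in> p"
      by (auto simp: S_def)
    note pa = periodic_orbit_point[OF p(1) a]
    have m1: "k * card p \<ge> 1" using p(2) pa(4) by simp
    have per: "(shift ^^ (k * card p)) a = a"
      using pa(2) funpow_mod_eq[of "card p" shift a "k * card p"] by simp
    have "cyclic_word (map a [0..<k * card p]) = a" by (rule cyclic_word_map_upt[OF per m1])
    then show "((orbit (cyclic_word (map (snd z) [0..<snd (fst z) * card (fst (fst z))])),
          length (map (snd z) [0..<snd (fst z) * card (fst (fst z))]) div
            card (orbit (cyclic_word (map (snd z) [0..<snd (fst z) * card (fst (fst z))])))),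
          cyclic_word (map (snd z) [0..<snd (fst z) * card (fst (fst z))])) = z"
      using pa(1,4) by (simp add: z)
    have "a \<in> words N" using periodic_orbit_properties(4)[OF p(1)] a by auto
    then have "a i \<in> {1..N}" for i by (auto simp: words_def)
    then show "map (snd z) [0..<snd (fst z) * card (fst (fst z))]
        \<in> {u \<in> lists {1..N}. u \<noteq> [] \<and> word_weight w u \<le> ln x}"
      using word_weight_periodic_orbit[OF p(1) a, of w k] p(3) m1 by (auto simp: z)
    show "w (hd (map (snd z) [0..<snd (fst z) * card (fst (fst z))])) = w (snd z 0)"
      using m1 by (simp add: z hd_map)
  next
    fix u assume "u \<in> {u \<in> lists {1..N}. u \<noteq> [] \<and> word_weight w u \<le> ln x}"
    then have u: "u \<in> lists {1..N}" "u \<noteq> []" "word_weight w u \<le> ln x" by auto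
    define p where "p = orbit (cyclic_word u)"
    note cu = cyclic_word[OF u(1,2)]
    have p: "p \<in> periodic_orbits N" using cu(2) by (simp add: p_def)
    have a: "cyclic_word u \<in> p" unfolding p_def by (rule range_eqI[of _ _ 0]) simp
    have "card p dvd length u" by (rule card_orbit_dvd_period[OF p a cu(1)])
    then have len: "length u div card p * card p = length u" by simp
    then have "length u div card p \<ge> 1" using u(2) by (cases "length u div card p") auto
    moreover have "real (length u div card p) * total_weight ?W p = word_weight w u"
      using word_weight_periodic_orbit[OF p a, of w "length u div card p"] len cu(3) by simp
    ultimately show "((orbit (cyclic_word u), length u div card (orbit (cyclic_word u))), cyclic_word u)
        \<in> Sigma S fst"
      using p a u(3) by (simp add: S_def p_def[symmetric])
    show "map (snd ((orbit (cyclic_word u), length u div card (orbit (cyclic_word u))), cyclic_word u))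
        [0..<snd (fst ((orbit (cyclic_word u), length u div card (orbit (cyclic_word u))), cyclic_word u)) *
          card (fst (fst ((orbit (cyclic_word u), length u div card (orbit (cyclic_word u))), cyclic_word u)))]
        = u"
      using len cu(3) by (simp add: p_def[symmetric])
  qed
  also have "\<dots> = (\<Sum>j=1..N. w j * real (word_count N w (ln x - w j)))" by (rule sum_hd_words[OF flow])
  finally show ?thesis .
qed

section \<open>The Fejer kernel\<close>

text \<open>The single form of Fubini's theorem that all interchanges of integrals below are instances of.\<close>

lemma
  fixes K G :: "real \<Rightarrow> 'a :: {real_normed_field, banach, second_countable_topology}"
    and f :: "real \<Rightarrow> real \<Rightarrow> 'a"
  assumes K: "integrable lborel K" and G: "integrable lborel G"
    and f[measurable]: "case_prod f \<in> borel_measurable (borel \<Otimes>\<^sub>M borel)"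
    and B: "\<And>u s. norm (f u s) \<le> B"
  shows swap_integrals: "(\<integral>s. G s * (\<integral>u. K u * f u s \<partial>lborel) \<partial>lborel)
       = (\<integral>u. K u * (\<integral>s. G s * f u s \<partial>lborel) \<partial>lborel)"
    and integrable_swap_integrals: "integrable lborel (\<lambda>u. K u * (\<integral>s. G s * f u s \<partial>lborel))"
proof -
  have [measurable]: "K \<in> borel_measurable borel" "G \<in> borel_measurable borel"
    using K G by (auto dest: borel_measurable_integrable)
  have *: "integrable (lborel \<Otimes>\<^sub>M lborel) (\<lambda>(u, s). K u * G s)"
    by (rule lborel_pair.Fubini_integrable) (use K G in \<open>auto simp: norm_mult\<close>)
  have "integrable (lborel \<Otimes>\<^sub>M lborel) (\<lambda>z. of_real B * (case z of (u, s) \<Rightarrow> K u * G s))"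
    by (intro integrable_mult_right *)
  then have i: "integrable (lborel \<Otimes>\<^sub>M lborel) (\<lambda>(u, s). K u * G s * f u s)"
  proof (rule Bochner_Integration.integrable_bound)
    show "(\<lambda>(u, s). K u * G s * f u s) \<in> borel_measurable (lborel \<Otimes>\<^sub>M lborel)" by measurable
    have B0: "0 \<le> B" using B[of 0 0] norm_ge_zero order_trans by blast
    have "norm (K u * G s * f u s) \<le> norm (of_real B * (K u * G s))" for u s
      using mult_right_mono[OF B[of u s], of "norm (K u * G s)"] B0
      by (simp add: norm_mult mult.commute)
    then show "AE z in lborel \<Otimes>\<^sub>M lborel.
      norm (case z of (u, s) \<Rightarrow> K u * G s * f u s)
        \<le> norm (of_real B * (case z of (u, s) \<Rightarrow> K u * G s))" by auto
  qed
  from lborel_pair.Fubini_integral[OF i]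
  have "(\<integral>s. (\<integral>u. K u * G s * f u s \<partial>lborel) \<partial>lborel) = (\<integral>u. (\<integral>s. K u * G s * f u s \<partial>lborel) \<partial>lborel)" .
  moreover have "(\<integral>u. K u * G s * f u s \<partial>lborel) = G s * (\<integral>u. K u * f u s \<partial>lborel)" for s
    by (subst integral_mult_right_zero[symmetric]) (simp add: ac_simps)
  moreover have eq: "(\<integral>s. K u * G s * f u s \<partial>lborel) = K u * (\<integral>s. G s * f u s \<partial>lborel)" for u
    by (subst integral_mult_right_zero[symmetric]) (simp add: ac_simps)
  ultimately show "(\<integral>s. G s * (\<integral>u. K u * f u s \<partial>lborel) \<partial>lborel)
       = (\<integral>u. K u * (\<integral>s. G s * f u s \<partial>lborel) \<partial>lborel)" by simp
  show "integrable lborel (\<lambda>u. K u * (\<integral>s. G s * f u s \<partial>lborel))"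
    using lborel_pair.integrable_fst[OF i] by (simp add: eq)
qed

lemma inverse_square_tail:
  fixes X :: real
  assumes X: "0 < X"
  shows "has_bochner_integral lborel (\<lambda>x. indicator {x. X \<le> \<bar>x\<bar>} x * (1 / x\<^sup>2)) (2 / X)"
proof -
  have "(\<integral>\<^sup>+x. ennreal (1 / x\<^sup>2) * indicator {X ..} x \<partial>lborel) = ennreal (0 - (- 1 / X))"
  proof (rule nn_integral_FTC_atLeast)
    show "((\<lambda>x. - 1 / x) has_real_derivative 1 / x\<^sup>2) (at x)" if "X \<le> x" for x
      using that X by (auto intro!: derivative_eq_intros simp: power2_eq_square)
    show "((\<lambda>x::real. - 1 / x) \<longlongrightarrow> 0) at_top"
      by (intro tendsto_divide_0[OF tendsto_const] filterlim_at_top_imp_at_infinity filterlim_ident)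
  qed auto
  moreover have "ennreal (1 / x\<^sup>2) * indicator {X ..} x = ennreal (indicator {X..} x * (1 / x\<^sup>2))" for x
    by (simp add: indicator_def)
  ultimately have "has_bochner_integral lborel (\<lambda>x. indicator {X..} x * (1 / x\<^sup>2)) (1 / X)"
    using X by (intro has_bochner_integral_nn_integral) auto
  then have r: "integrable lborel (\<lambda>x. indicator {X..} x * (1 / x\<^sup>2))"
    "(\<integral>x. indicator {X..} x * (1 / x\<^sup>2) \<partial>lborel) = 1 / X"
    by (auto simp: has_bochner_integral_iff)
  have l: "integrable lborel (\<lambda>x. indicator {X..} (- x) * (1 / (- x)\<^sup>2))"
    "(\<integral>x. indicator {X..} (- x) * (1 / (- x)\<^sup>2) \<partial>lborel) = 1 / X"
    using lborel_integrable_real_affine[OF r(1), of "-1" 0]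
      lborel_integral_real_affine[of "-1" "\<lambda>x. indicator {X..} x * (1 / x\<^sup>2)" 0] r(2)
    by simp_all
  have "(\<lambda>x. indicator {x. X \<le> \<bar>x\<bar>} x * (1 / x\<^sup>2)) =
      (\<lambda>x. indicator {X..} x * (1 / x\<^sup>2) + indicator {X..} (- x) * (1 / (- x)\<^sup>2))"
    using X by (auto simp: fun_eq_iff indicator_def abs_if)
  then show ?thesis using r l by (simp add: has_bochner_integral_iff)
qed

text \<open>The kernel is defined by its Fourier transform, a triangle supported in \<open>[-T, T]\<close> (written on
  \<open>[0, T]\<close> with a cosine), so that a convolution with it involves only the frequencies up to \<open>T\<close>. The constant
  \<open>fejer_mass\<close>, which equals \<open>\<pi>\<close>, normalizes the kernel to mass 1.\<close>

definition fejer_mass :: real where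
  "fejer_mass = (\<integral>x. (1 - cos x) / x\<^sup>2 \<partial>lborel)"

definition fejer_weight :: "real \<Rightarrow> real \<Rightarrow> real" where
  "fejer_weight T t = indicator {0..T} t * (1 - t / T) / fejer_mass"

definition fejer :: "real \<Rightarrow> real \<Rightarrow> real" where
  "fejer T u = (\<integral>t. fejer_weight T t * cos (t * u) \<partial>lborel)"

lemma one_minus_cos_over_square_le: "(1 - cos x) / x\<^sup>2 \<le> (1 / 2 :: real)"
proof (cases "x = 0")
  case False
  have "1 - cos x = 2 * (sin (x / 2))\<^sup>2" using cos_double_sin[of "x / 2"] by simp
  also have "\<dots> \<le> 2 * (x / 2)\<^sup>2"
    using abs_sin_x_le_abs_x[of "x / 2"] by (intro mult_left_mono) (simp_all only: abs_le_square_iff[symmetric] zero_le_numeral)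
  finally show ?thesis using False by (simp add: divide_le_eq power2_eq_square)
qed simp

lemma integrable_one_minus_cos_over_square: "integrable lborel (\<lambda>x::real. (1 - cos x) / x\<^sup>2)"
proof (rule Bochner_Integration.integrable_bound)
  show "integrable lborel (\<lambda>x::real. indicator {-1..1} x * (1 / 2) + 2 * (indicator {x. 1 \<le> \<bar>x\<bar>} x * (1 / x\<^sup>2)))"
    using inverse_square_tail[of 1] by (intro Bochner_Integration.integrable_add integrable_mult_right)
      (auto simp: has_bochner_integral_iff)
  have "\<bar>(1 - cos x) / x\<^sup>2\<bar> \<le> indicator {-1..1} x * (1 / 2) + 2 * (indicator {x. 1 \<le> \<bar>x\<bar>} x * (1 / x\<^sup>2))"
    for x :: real
  proof (cases "1 \<le> \<bar>x\<bar>")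
    case True
    have "(1 - cos x) / x\<^sup>2 \<le> 2 / x\<^sup>2" by (intro divide_right_mono) auto
    then show ?thesis using True by (auto simp: indicator_def)
  next
    case False
    then show ?thesis using one_minus_cos_over_square_le[of x] by (auto simp: indicator_def)
  qed
  then show "AE x::real in lborel. norm ((1 - cos x) / x\<^sup>2) \<le>
      norm (indicator {-1..1} x * (1 / 2) + 2 * (indicator {x. 1 \<le> \<bar>x\<bar>} x * (1 / x\<^sup>2)))"
    by (auto intro!: always_eventually order_trans[OF _ abs_ge_self])
qed measurable

lemma fejer_mass_pos: "fejer_mass > 0"
proof -
  have "fejer_mass \<ge> 0" unfolding fejer_mass_def by (intro integral_nonneg_AE) auto
  moreover have "fejer_mass \<noteq> 0"
  proof
    assume "fejer_mass = 0"
    then have "AE x::real in lborel. (1 - cos x) / x\<^sup>2 = 0"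
      unfolding fejer_mass_def
      by (subst (asm) integral_nonneg_eq_0_iff_AE[OF integrable_one_minus_cos_over_square]) auto
    then have "AE x::real in lborel. x \<notin> {1..2}"
    proof eventually_elim
      case (elim x)
      have "cos x < 1" if "1 \<le> x" "x \<le> 2"
        using cos_monotone_0_pi[of 0 x] that pi_gt3 by simp
      then show ?case using elim by auto
    qed
    then have "emeasure lborel {x \<in> space lborel. x \<in> {1..2::real}} = 0"
      by (intro emeasure_eq_0_AE)
    moreover have "{x \<in> space lborel. x \<in> {1..2::real}} = {1..2}" by auto
    ultimately show False by simp
  qed
  ultimately show ?thesis by simp
qed

lemma integrable_fejer_weight: "integrable lborel (fejer_weight T)"
proof -
  have "integrable lborel (\<lambda>t. indicator {0..T} t *\<^sub>R (1 - t / T))"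
    by (rule borel_integrable_compact) (auto simp: divide_inverse intro!: continuous_intros)
  then have "integrable lborel (\<lambda>t. indicator {0..T} t * (1 - t / T) / fejer_mass)"
    by (intro integrable_divide) simp
  then show ?thesis unfolding fejer_weight_def[abs_def] .
qed

lemma fejer_weight_bounds:
  assumes "0 < T"
  shows "0 \<le> fejer_weight T t" "fejer_weight T t \<le> indicator {0..T} t / fejer_mass"
  using fejer_mass_pos assms by (auto simp: fejer_weight_def indicator_def field_simps)

lemma fejer_closed_form:
  assumes T: "0 < T" and u: "u \<noteq> 0"
  shows "fejer T u = (1 - cos (T * u)) / (T * u\<^sup>2) / fejer_mass"
proof -
  have "(\<integral>t. ((1 - t / T) * cos (t * u)) * indicator {0..T} t \<partial>lborel)
      = ((1 - T / T) * sin (T * u) / u - cos (T * u) / (T * u\<^sup>2))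
       - ((1 - 0 / T) * sin (0 * u) / u - cos (0 * u) / (T * u\<^sup>2))"
  proof (rule integral_FTC_Icc_real)
    show "((\<lambda>t. (1 - t / T) * sin (t * u) / u - cos (t * u) / (T * u\<^sup>2))
        has_real_derivative (1 - t / T) * cos (t * u)) (at t)" for t
      using T u by (auto intro!: derivative_eq_intros simp: field_simps power2_eq_square)
  qed (use T in \<open>auto intro!: continuous_intros\<close>)
  also have "\<dots> = (1 - cos (T * u)) / (T * u\<^sup>2)" using T by (simp add: diff_divide_distrib)
  finally have "(\<integral>t. ((1 - t / T) * cos (t * u)) * indicator {0..T} t \<partial>lborel) / fejer_mass
      = (1 - cos (T * u)) / (T * u\<^sup>2) / fejer_mass" by simp
  then show ?thesis unfolding fejer_def fejer_weight_def
    by (subst (asm) integral_divide_zero[symmetric]) (simp add: ac_simps)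
qed

lemma borel_measurable_fejer [measurable]: "fejer T \<in> borel_measurable borel"
  unfolding fejer_def[abs_def] fejer_weight_def by measurable

lemma AE_fejer:
  assumes T: "0 < T"
  shows "AE u in lborel. fejer T u = T * ((1 - cos (T * u)) / (T * u)\<^sup>2) / fejer_mass"
proof -
  have "AE u in lborel. u \<noteq> (0::real)" by (rule AE_lborel_singleton)
  then show ?thesis
  proof eventually_elim
    case (elim u)
    have "T * ((1 - cos (T * u)) / (T * u)\<^sup>2) = (1 - cos (T * u)) / (T * u\<^sup>2)"
      using T by (simp add: power2_eq_square)
    then show ?case using fejer_closed_form[OF T elim] by simp
  qed
qed

lemma fejer_nonneg: "0 < T \<Longrightarrow> 0 \<le> fejer T u"
proof (cases "u = 0")
  case True
  assume "0 < T"
  then show ?thesis unfolding True fejer_def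
    by (intro integral_nonneg_AE) (auto simp: fejer_weight_bounds)
qed (use fejer_mass_pos in \<open>auto simp: fejer_closed_form\<close>)

lemma has_bochner_integral_fejer:
  assumes T: "0 < T"
  shows "has_bochner_integral lborel (fejer T) 1"
proof -
  let ?g = "\<lambda>x::real. (1 - cos x) / x\<^sup>2"
  have "integrable lborel (\<lambda>u. ?g (0 + T * u))"
    using T by (intro lborel_integrable_real_affine integrable_one_minus_cos_over_square) auto
  moreover have "fejer_mass = T * (\<integral>u. ?g (0 + T * u) \<partial>lborel)"
    unfolding fejer_mass_def using T by (subst lborel_integral_real_affine[of T _ 0]) simp_all
  ultimately have "has_bochner_integral lborel (\<lambda>u. T * ?g (T * u) / fejer_mass) 1"
    using fejer_mass_pos by (simp add: has_bochner_integral_iff del: times_divide_eq_right)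
  moreover have "has_bochner_integral lborel (fejer T) 1
      \<longleftrightarrow> has_bochner_integral lborel (\<lambda>u. T * ?g (T * u) / fejer_mass) 1"
    by (rule has_bochner_integral_cong_AE) (use AE_fejer[OF T] in auto)
  ultimately show ?thesis by simp
qed

lemmas integrable_fejer = has_bochner_integral_fejer[THEN integrable.intros]
lemmas integral_fejer = has_bochner_integral_fejer[THEN has_bochner_integral_integral_eq]

lemma fejer_tail:
  assumes T: "0 < T" and X: "0 < X"
  shows "(\<integral>u. indicator {u. X \<le> \<bar>u\<bar>} u * fejer T u \<partial>lborel) \<le> 4 / fejer_mass / (T * X)"
proof -
  note tail = inverse_square_tail[OF X, unfolded has_bochner_integral_iff]
  have "(\<integral>u. indicator {u. X \<le> \<bar>u\<bar>} u * fejer T u \<partial>lborel)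
      \<le> (\<integral>u. 2 / (T * fejer_mass) * (indicator {u. X \<le> \<bar>u\<bar>} u * (1 / u\<^sup>2)) \<partial>lborel)"
  proof (rule integral_mono)
    have "integrable lborel (\<lambda>u. indicator {u. X \<le> \<bar>u\<bar>} u *\<^sub>R fejer T u)"
      by (rule integrable_mult_indicator[OF _ integrable_fejer[OF T]]) measurable
    then show "integrable lborel (\<lambda>u. indicator {u. X \<le> \<bar>u\<bar>} u * fejer T u)" by simp
    show "integrable lborel (\<lambda>u. 2 / (T * fejer_mass) * (indicator {u. X \<le> \<bar>u\<bar>} u * (1 / u\<^sup>2)))"
      using tail by (intro integrable_mult_right) auto
    fix u :: real
    show "indicator {u. X \<le> \<bar>u\<bar>} u * fejer T u
        \<le> 2 / (T * fejer_mass) * (indicator {u. X \<le> \<bar>u\<bar>} u * (1 / u\<^sup>2))"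
    proof (cases "X \<le> \<bar>u\<bar>")
      case True
      then have "u \<noteq> 0" using X by auto
      have "fejer T u \<le> 2 / (T * u\<^sup>2) / fejer_mass"
        unfolding fejer_closed_form[OF T \<open>u \<noteq> 0\<close>]
        using T fejer_mass_pos cos_ge_minus_one[of "T * u"] by (intro divide_right_mono) auto
      then show ?thesis using True by (simp add: ac_simps)
    qed simp
  qed
  also have "\<dots> = 4 / fejer_mass / (T * X)"
    by (subst integral_mult_right_zero) (use tail in simp)
  finally show ?thesis .
qed

lemma integrable_bounded_fejer:
  assumes T: "0 < T" and [measurable]: "h \<in> borel_measurable borel" and C: "\<And>v. \<bar>h v\<bar> \<le> C"
  shows "integrable lborel (\<lambda>u. h (y - u) * fejer T u)"
proof (rule Bochner_Integration.integrable_bound)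
  show "integrable lborel (\<lambda>u. C * fejer T u)" by (intro integrable_mult_right integrable_fejer[OF T])
  have "\<bar>h (y - u)\<bar> * fejer T u \<le> C * fejer T u" for u
    by (intro mult_right_mono C fejer_nonneg[OF T])
  then show "AE u in lborel. norm (h (y - u) * fejer T u) \<le> norm (C * fejer T u)"
    using C[of 0] fejer_nonneg[OF T] by (auto simp: abs_mult)
qed measurable

text \<open>A one-sided bound near \<open>y\<close> passes to the average at \<open>y\<close>: the kernel is nonnegative of mass 1,
  and the part of its mass farther than \<open>X\<close> from the origin is \<open>O(1/(T X))\<close>.\<close>

lemma fejer_average_ge:
  assumes T: "0 < T" and X: "0 < X" and [measurable]: "h \<in> borel_measurable borel"
    and C: "\<And>v. \<bar>h v\<bar> \<le> C" and \<beta>: "\<And>u. \<bar>u\<bar> \<le> X \<Longrightarrow> \<beta> \<le> h (y - u)" "\<beta> \<le> C"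
  shows "\<beta> - 8 * C / fejer_mass / (T * X) \<le> (\<integral>u. h (y - u) * fejer T u \<partial>lborel)"
proof -
  have "integrable lborel (\<lambda>u. indicator {u. X \<le> \<bar>u\<bar>} u *\<^sub>R fejer T u)"
    by (rule integrable_mult_indicator[OF _ integrable_fejer[OF T]]) measurable
  then have i: "integrable lborel (\<lambda>u. 2 * C * (indicator {u. X \<le> \<bar>u\<bar>} u * fejer T u))"
    by (intro integrable_mult_right) simp
  have "0 \<le> C" using C[of 0] by linarith
  then have "\<beta> - 8 * C / fejer_mass / (T * X)
      \<le> \<beta> * 1 - 2 * C * (\<integral>u. indicator {u. X \<le> \<bar>u\<bar>} u * fejer T u \<partial>lborel)"
    using mult_left_mono[OF fejer_tail[OF T X], of "2 * C"] by simp
  also have "\<dots> = (\<integral>u. \<beta> * fejer T u - 2 * C * (indicator {u. X \<le> \<bar>u\<bar>} u * fejer T u) \<partial>lborel)"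
    using integrable_fejer[OF T] integral_fejer[OF T] i
    by (subst Bochner_Integration.integral_diff) simp_all
  also have "\<dots> \<le> (\<integral>u. h (y - u) * fejer T u \<partial>lborel)"
  proof (rule integral_mono)
    show "integrable lborel (\<lambda>u. \<beta> * fejer T u - 2 * C * (indicator {u. X \<le> \<bar>u\<bar>} u * fejer T u))"
      using integrable_fejer[OF T] i by (intro Bochner_Integration.integrable_diff) auto
    show "integrable lborel (\<lambda>u. h (y - u) * fejer T u)"
      by (rule integrable_bounded_fejer[OF T _ C]) measurable
    fix u
    have "\<beta> - 2 * C * indicator {u. X \<le> \<bar>u\<bar>} u \<le> h (y - u)"
    proof (cases "X \<le> \<bar>u\<bar>")
      case True
      then show ?thesis using \<beta>(2) C[of "y - u"] by (simp add: abs_le_iff)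
    next
      case False
      then show ?thesis using \<beta>(1)[of u] by simp
    qed
    from mult_right_mono[OF this fejer_nonneg[OF T, of u]]
    show "\<beta> * fejer T u - 2 * C * (indicator {u. X \<le> \<bar>u\<bar>} u * fejer T u) \<le> h (y - u) * fejer T u"
      by (simp add: algebra_simps)
  qed
  finally show ?thesis .
qed

lemma fejer_average_le:
  assumes T: "0 < T" and X: "0 < X" and [measurable]: "h \<in> borel_measurable borel"
    and C: "\<And>v. \<bar>h v\<bar> \<le> C" and \<beta>: "\<And>u. \<bar>u\<bar> \<le> X \<Longrightarrow> h (y - u) \<le> \<beta>" "- C \<le> \<beta>"
  shows "(\<integral>u. h (y - u) * fejer T u \<partial>lborel) \<le> \<beta> + 8 * C / fejer_mass / (T * X)"
  using fejer_average_ge[OF T X, of "\<lambda>v. - h v" C "- \<beta>" y] C \<beta> by simp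

lemma fejer_average_abs_le:
  assumes T: "0 < T" and X: "0 < X" and [measurable]: "h \<in> borel_measurable borel"
    and C: "\<And>v. \<bar>h v\<bar> \<le> C" and \<epsilon>: "\<And>u. \<bar>u\<bar> \<le> X \<Longrightarrow> \<bar>h (y - u)\<bar> \<le> \<epsilon>"
  shows "\<bar>\<integral>u. h (y - u) * fejer T u \<partial>lborel\<bar> \<le> \<epsilon> + 8 * C / fejer_mass / (T * X)"
proof -
  have "0 \<le> C" "0 \<le> \<epsilon>" using C[of 0] \<epsilon>[of 0] X by auto
  moreover have "h (y - u) \<le> \<epsilon>" "- \<epsilon> \<le> h (y - u)" if "\<bar>u\<bar> \<le> X" for u
    using \<epsilon>[OF that] by auto
  ultimately show ?thesis
    using fejer_average_ge[OF T X, of h C "- \<epsilon>" y] fejer_average_le[OF T X, of h C y \<epsilon>] C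
    by (auto simp: abs_le_iff)
qed

section \<open>Filtering by a Fourier multiplier\<close>

lemma power_mult_exp_minus_le:
  fixes x :: real
  assumes "0 \<le> x" "1 \<le> r"
  shows "x ^ r * exp (- x) \<le> real r ^ r"
proof -
  have "x / real r \<le> exp (x / real r)" using exp_ge_add_one_self[of "x / real r"] by linarith
  then have "(x / real r) ^ r \<le> exp (x / real r) ^ r" using assms by (intro power_mono) auto
  also have "\<dots> = exp x" using assms by (simp flip: exp_of_nat_mult)
  finally have "x ^ r \<le> real r ^ r * exp x" using assms by (simp add: power_divide field_simps)
  then show ?thesis by (simp add: exp_minus field_simps)
qed

lemma borel_measurable_cis [measurable]: "cis \<in> borel_measurable borel"
  by (intro borel_measurable_continuous_onI) (auto intro!: continuous_intros)

lemma norm_one_minus_cis_le: "norm (1 - cis x) \<le> \<bar>x\<bar>"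
proof -
  have "norm (1 - cis x) = 2 * \<bar>sin (x / 2)\<bar>"
    by (metis dist_exp_i_1 dist_norm norm_minus_commute cis_conv_exp)
  also have "\<dots> \<le> 2 * \<bar>x / 2\<bar>" by (intro mult_left_mono abs_sin_x_le_abs_x) auto
  finally show ?thesis by simp
qed

definition multiplier :: "(real \<Rightarrow> complex) \<Rightarrow> bool" where
  "multiplier q \<longleftrightarrow> q \<in> borel_measurable borel \<and> (\<exists>B. \<forall>t. norm (q t) \<le> B)"

lemma multiplier_const: "multiplier (\<lambda>_. c)"
  by (auto simp: multiplier_def)

lemma multiplier_mult: "multiplier q \<Longrightarrow> multiplier r \<Longrightarrow> multiplier (\<lambda>t. q t * r t)"
  unfolding multiplier_def norm_mult
  by (blast intro: borel_measurable_times mult_mono' norm_ge_zero)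

lemma multiplier_diff: "multiplier q \<Longrightarrow> multiplier r \<Longrightarrow> multiplier (\<lambda>t. q t - r t)"
  unfolding multiplier_def
  by (blast intro: borel_measurable_diff norm_diff_triangle_le order_trans[OF norm_triangle_ineq4 add_mono])

lemma multiplier_add: "multiplier q \<Longrightarrow> multiplier r \<Longrightarrow> multiplier (\<lambda>t. q t + r t)"
  unfolding multiplier_def
  by (blast intro: borel_measurable_add order_trans[OF norm_triangle_ineq add_mono])

lemma multiplier_power: "multiplier q \<Longrightarrow> multiplier (\<lambda>t. q t ^ n)"
  by (induction n) (auto intro: multiplier_const multiplier_mult)

lemmas multiplier_intros = multiplier_const multiplier_mult multiplier_diff multiplier_add multiplier_power

definition fourier :: "(real \<Rightarrow> real) \<Rightarrow> real \<Rightarrow> complex" where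
  "fourier b t = (\<integral>v. complex_of_real (b v) * cis (- t * v) \<partial>lborel)"

text \<open>The convolution of \<open>b\<close> with the Fejer kernel, followed by the operator with Fourier symbol \<open>q\<close>.
  Positive frequencies suffice because all operators in question are real, whence the real part.\<close>

definition filtered :: "real \<Rightarrow> (real \<Rightarrow> real) \<Rightarrow> (real \<Rightarrow> complex) \<Rightarrow> real \<Rightarrow> real" where
  "filtered T b q y =
     Re (\<integral>t. complex_of_real (fejer_weight T t) * fourier b t * q t * cis (t * y) \<partial>lborel)"

lemma norm_fourier_le:
  assumes "integrable lborel b"
  shows "norm (fourier b t) \<le> (\<integral>v. \<bar>b v\<bar> \<partial>lborel)"
proof -
  have "norm (fourier b t) \<le> (\<integral>v. norm (complex_of_real (b v) * cis (- t * v)) \<partial>lborel)"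
    unfolding fourier_def by (rule integral_norm_bound)
  then show ?thesis by (simp add: norm_mult)
qed

lemma multiplier_fourier:
  assumes b: "integrable lborel b"
  shows "multiplier (fourier b)"
proof -
  have [measurable]: "b \<in> borel_measurable borel" using b by auto
  have "fourier b \<in> borel_measurable borel" unfolding fourier_def[abs_def] by measurable
  then show ?thesis using norm_fourier_le[OF b] by (auto simp: multiplier_def)
qed

lemma integrable_filtered:
  assumes b: "integrable lborel b" and q: "multiplier q"
  shows "integrable lborel (\<lambda>t. complex_of_real (fejer_weight T t) * fourier b t * q t)"
proof -
  obtain B where B: "\<And>t. norm (fourier b t * q t) \<le> B"
    using multiplier_mult[OF multiplier_fourier[OF b] q] unfolding multiplier_def by blast
  have [measurable]: "q \<in> borel_measurable borel" "fourier b \<in> borel_measurable borel"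
      "fejer_weight T \<in> borel_measurable borel"
    using q multiplier_fourier[OF b] integrable_fejer_weight[of T] by (auto simp: multiplier_def)
  show ?thesis
  proof (rule Bochner_Integration.integrable_bound)
    show "integrable lborel (\<lambda>t. fejer_weight T t * B)"
      by (intro integrable_mult_left integrable_fejer_weight)
    have "norm (complex_of_real (fejer_weight T t) * fourier b t * q t) \<le> norm (fejer_weight T t * B)" for t
      using mult_left_mono[OF order_trans[OF B[of t] abs_ge_self], of "\<bar>fejer_weight T t\<bar>"]
      by (simp add: norm_mult abs_mult mult.assoc)
    then show "AE t in lborel. norm (complex_of_real (fejer_weight T t) * fourier b t * q t)
        \<le> norm (fejer_weight T t * B)" by simp
  qed measurable
qed

lemma integrable_filtered':
  assumes b: "integrable lborel b" and q: "multiplier q"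
  shows "integrable lborel (\<lambda>t. complex_of_real (fejer_weight T t) * fourier b t * q t * cis (t * y))"
proof -
  have "multiplier (\<lambda>t. cis (t * y))" by (auto simp: multiplier_def)
  from integrable_filtered[OF b multiplier_mult[OF q this]] show ?thesis by (simp add: mult.assoc)
qed

lemma filtered_diff:
  assumes "integrable lborel b" "multiplier q" "multiplier r"
  shows "filtered T b (\<lambda>t. q t - r t) y = filtered T b q y - filtered T b r y"
  using integrable_filtered'[OF assms(1,2), of T y] integrable_filtered'[OF assms(1,3), of T y]
  unfolding filtered_def by (simp add: algebra_simps)

lemma filtered_cmult:
  "filtered T b (\<lambda>t. q t * complex_of_real c) y = c * filtered T b q y"
proof -
  have "(\<lambda>t. complex_of_real (fejer_weight T t) * fourier b t * (q t * complex_of_real c) * cis (t * y))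
      = (\<lambda>t. complex_of_real c * (complex_of_real (fejer_weight T t) * fourier b t * q t * cis (t * y)))"
    by (simp add: ac_simps)
  then show ?thesis unfolding filtered_def by simp
qed

lemma filtered_sum:
  assumes "integrable lborel b" "\<And>j. j \<in> J \<Longrightarrow> multiplier (q j)"
  shows "filtered T b (\<lambda>t. \<Sum>j\<in>J. q j t) y = (\<Sum>j\<in>J. filtered T b (q j) y)"
  using integrable_filtered'[OF assms(1) assms(2), of _ T y]
  unfolding filtered_def by (simp add: sum_distrib_left sum_distrib_right)

lemma filtered_translation:
  "filtered T b (\<lambda>t. q t * cis (- t * s)) y = filtered T b q (y - s)"
proof -
  have *: "q t * cis (- t * s) * cis (t * y) = q t * cis (t * (y - s))" for t
    by (simp add: mult.assoc cis_mult right_diff_distrib)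
  show ?thesis unfolding filtered_def mult.assoc[of "_ * _" "q _ * _"]
    by (intro arg_cong[where f = Re] Bochner_Integration.integral_cong refl) (metis * mult.assoc)
qed

lemma filtered_one:
  assumes T: "0 < T" and b: "integrable lborel b"
  shows "filtered T b (\<lambda>_. 1) y = (\<integral>u. b (y - u) * fejer T u \<partial>lborel)"
proof -
  have [measurable]: "b \<in> borel_measurable borel" using b by auto
  have F: "Re (\<integral>t. complex_of_real (fejer_weight T t) * cis (t * u) \<partial>lborel) = fejer T u" for u
  proof -
    have "integrable lborel (\<lambda>t. complex_of_real (fejer_weight T t) * cis (t * u))"
    proof (rule Bochner_Integration.integrable_bound[OF integrable_fejer_weight[of T]])
      have [measurable]: "fejer_weight T \<in> borel_measurable borel" using integrable_fejer_weight by auto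
      show "(\<lambda>t. complex_of_real (fejer_weight T t) * cis (t * u)) \<in> borel_measurable lborel" by measurable
    qed (simp add: norm_mult)
    then show ?thesis by (simp add: fejer_def flip: integral_Re)
  qed
  have "(\<integral>t. complex_of_real (fejer_weight T t) * fourier b t * 1 * cis (t * y) \<partial>lborel)
      = (\<integral>t. complex_of_real (fejer_weight T t) *
          (\<integral>v. complex_of_real (b v) * cis (t * (y - v)) \<partial>lborel) \<partial>lborel)"
  proof (rule Bochner_Integration.integral_cong[OF refl])
    fix t
    have "(\<integral>v. complex_of_real (b v) * cis (t * (y - v)) \<partial>lborel)
        = (\<integral>v. complex_of_real (b v) * cis (- t * v) * cis (t * y) \<partial>lborel)"
      by (simp add: mult.assoc cis_mult algebra_simps)
    then show "complex_of_real (fejer_weight T t) * fourier b t * 1 * cis (t * y) =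
        complex_of_real (fejer_weight T t) * (\<integral>v. complex_of_real (b v) * cis (t * (y - v)) \<partial>lborel)"
      by (simp add: fourier_def)
  qed
  also have "\<dots> = (\<integral>v. complex_of_real (b v) *
      (\<integral>t. complex_of_real (fejer_weight T t) * cis (t * (y - v)) \<partial>lborel) \<partial>lborel)"
    using b integrable_fejer_weight by (intro swap_integrals[where B = 1]) auto
  finally have eq: "filtered T b (\<lambda>_. 1) y = Re (\<integral>v. complex_of_real (b v) *
      (\<integral>t. complex_of_real (fejer_weight T t) * cis (t * (y - v)) \<partial>lborel) \<partial>lborel)" (is "_ = Re (\<integral>v. ?g v \<partial>lborel)")
    unfolding filtered_def by simp
  have "integrable lborel ?g"
    using b integrable_fejer_weight by (intro integrable_swap_integrals[where B = 1]) auto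
  then have "filtered T b (\<lambda>_. 1) y = (\<integral>v. Re (?g v) \<partial>lborel)" using integral_Re[of lborel ?g] eq by (simp only:)
  also have "\<dots> = (\<integral>v. b v * fejer T (y - v) \<partial>lborel)" by (simp add: F)
  also have "\<dots> = (\<integral>u. b (y - u) * fejer T u \<partial>lborel)"
    by (subst lborel_integral_real_affine[of "-1" _ y]) simp_all
  finally show ?thesis .
qed

lemma abs_filtered_le:
  assumes T: "0 < T" and b: "integrable lborel b" and q: "multiplier q"
    and \<delta>: "\<And>t. t \<in> {0..T} \<Longrightarrow> norm (q t) \<le> \<delta>"
  shows "\<bar>filtered T b q y\<bar> \<le> T / fejer_mass * (\<integral>v. \<bar>b v\<bar> \<partial>lborel) * \<delta>"
proof -
  let ?B = "\<integral>v. \<bar>b v\<bar> \<partial>lborel"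
  have "\<bar>filtered T b q y\<bar> \<le> norm (\<integral>t. complex_of_real (fejer_weight T t) * fourier b t * q t * cis (t * y) \<partial>lborel)"
    unfolding filtered_def by (rule abs_Re_le_cmod)
  also have "\<dots> \<le> (\<integral>t. norm (complex_of_real (fejer_weight T t) * fourier b t * q t * cis (t * y)) \<partial>lborel)"
    by (rule integral_norm_bound)
  also have "\<dots> \<le> (\<integral>t. indicator {0..T} t * (1 / fejer_mass * ?B * \<delta>) \<partial>lborel)"
  proof (rule integral_mono)
    show "integrable lborel (\<lambda>t. norm (complex_of_real (fejer_weight T t) * fourier b t * q t * cis (t * y)))"
      by (intro integrable_norm integrable_filtered'[OF b q])
    show "integrable lborel (\<lambda>t. indicator {0..T} t * (1 / fejer_mass * ?B * \<delta>))"
      using T by (intro integrable_mult_left) simp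
    fix t
    show "norm (complex_of_real (fejer_weight T t) * fourier b t * q t * cis (t * y))
        \<le> indicator {0..T} t * (1 / fejer_mass * ?B * \<delta>)"
    proof (cases "t \<in> {0..T}")
      case True
      have "\<bar>fejer_weight T t\<bar> \<le> 1 / fejer_mass"
        using fejer_weight_bounds[OF T, of t] True by simp
      then have "\<bar>fejer_weight T t\<bar> * norm (fourier b t) * norm (q t) \<le> 1 / fejer_mass * ?B * \<delta>"
        using norm_fourier_le[OF b, of t] \<delta>[OF True] fejer_mass_pos
        by (intro mult_mono) auto
      then show ?thesis using True by (simp add: norm_mult)
    qed (simp add: fejer_weight_def)
  qed
  also have "\<dots> = T / fejer_mass * ?B * \<delta>" using T by simp
  finally show ?thesis .
qed

section \<open>The two averages of a step distribution\<close>

locale step_distribution =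
  fixes J :: "nat set" and p w :: "nat \<Rightarrow> real"
  assumes finite_J: "finite J" and p_pos: "j \<in> J \<Longrightarrow> 0 < p j" and w_pos: "j \<in> J \<Longrightarrow> 0 < w j"
    and sum_p: "sum p J = 1"
begin

definition mean :: real where "mean = (\<Sum>j\<in>J. p j * w j)"

definition max_step :: real where "max_step = Max (w ` J)"

lemma J_nonempty: "J \<noteq> {}" using sum_p by auto

lemma w_le_max_step: "j \<in> J \<Longrightarrow> w j \<le> max_step"
  unfolding max_step_def using finite_J by (intro Max_ge) auto

lemma max_step_pos: "0 < max_step"
  using J_nonempty w_pos w_le_max_step by fastforce

lemma mean_pos: "0 < mean"
  unfolding mean_def using finite_J J_nonempty p_pos w_pos by (intro sum_pos) auto

text \<open>The symbol of \<open>P f(y) = \<Sum>\<^sub>j p\<^sub>j f(y - w\<^sub>j)\<close>, and then that of the average \<open>Q\<close> over the residual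
  distribution of renewal theory, which has density \<open>Prob(step > s)/mean\<close>; the density is a mixture of the
  indicators of \<open>[0, w\<^sub>j]\<close>. One has \<open>charf_residual t = (1 - charf t) / (\<i> t mean)\<close>, so \<open>Q\<close> carries
  the information at frequency 0 that is lost in \<open>1 - P\<close>.\<close>

definition charf :: "real \<Rightarrow> complex" where
  "charf t = (\<Sum>j\<in>J. complex_of_real (p j) * cis (- t * w j))"

definition charf_residual :: "real \<Rightarrow> complex" where
  "charf_residual t =
     (\<Sum>j\<in>J. complex_of_real (p j / mean) * (\<integral>s. complex_of_real (indicator {0..w j} s) * cis (- t * s) \<partial>lborel))"

text \<open>The symbol of \<open>(1 + P)/2\<close>. Passing to the lazy walk is essential: \<open>\<bar>charf t\<bar>\<close> can be 1 although
  \<open>charf t\<close> is far from 1, but \<open>\<bar>lazy t\<bar>\<close> is close to 1 only if \<open>charf t\<close> is.\<close>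

definition lazy :: "real \<Rightarrow> complex" where "lazy t = (1 + charf t) / 2"

lemma multiplier_charf: "multiplier charf"
  unfolding multiplier_def
proof (intro conjI exI allI)
  show "charf \<in> borel_measurable borel" unfolding charf_def[abs_def] by measurable
  show "norm (charf t) \<le> (\<Sum>j\<in>J. \<bar>p j\<bar>)" for t
    unfolding charf_def by (rule order_trans[OF norm_sum]) (simp add: norm_mult)
qed

lemma norm_charf_le: "norm (charf t) \<le> 1"
proof -
  have "norm (charf t) \<le> (\<Sum>j\<in>J. \<bar>p j\<bar>)"
    unfolding charf_def by (rule order_trans[OF norm_sum]) (simp add: norm_mult)
  also have "\<dots> = 1" using sum_p p_pos by (simp add: abs_of_pos)
  finally show ?thesis .
qed

lemma one_minus_Re_charf: "1 - Re (charf t) = (\<Sum>j\<in>J. p j * (1 - cos (t * w j)))"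
  using sum_p by (simp add: charf_def right_diff_distrib sum_subtractf)

lemma multiplier_lazy: "multiplier lazy"
proof -
  have "multiplier (\<lambda>t. (1 + charf t) * (1 / 2))" by (intro multiplier_intros multiplier_charf)
  then show ?thesis unfolding lazy_def[abs_def] by simp
qed

lemma norm_integral_cis_le:
  assumes "0 \<le> a"
  shows "norm (\<integral>s. complex_of_real (indicator {0..a} s) * cis (- t * s) \<partial>lborel) \<le> a"
proof -
  have "norm (\<integral>s. complex_of_real (indicator {0..a} s) * cis (- t * s) \<partial>lborel)
      \<le> (\<integral>s. norm (complex_of_real (indicator {0..a} s) * cis (- t * s)) \<partial>lborel)"
    by (rule integral_norm_bound)
  also have "\<dots> = a" using assms by (simp add: norm_mult)
  finally show ?thesis .
qed

lemma sum_p_w_div_mean: "(\<Sum>j\<in>J. p j / mean * w j) = 1"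
  using mean_pos by (simp add: mean_def sum_divide_distrib[symmetric])

lemma norm_charf_residual_le: "norm (charf_residual t) \<le> 1"
proof -
  have "norm (charf_residual t) \<le> (\<Sum>j\<in>J. p j / mean * w j)"
    unfolding charf_residual_def
  proof (rule order_trans[OF norm_sum sum_mono])
    fix j assume j: "j \<in> J"
    have "0 \<le> p j / mean" using p_pos[OF j] mean_pos by simp
    then show "norm (complex_of_real (p j / mean) * (\<integral>s. complex_of_real (indicator {0..w j} s) * cis (- t * s) \<partial>lborel))
        \<le> p j / mean * w j"
      using norm_integral_cis_le[of "w j" t] w_pos[OF j] unfolding norm_mult norm_of_real
      by (intro mult_mono) auto
  qed
  then show ?thesis by (simp only: sum_p_w_div_mean)
qed

lemma multiplier_charf_residual: "multiplier charf_residual"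
proof -
  have "charf_residual \<in> borel_measurable borel" unfolding charf_residual_def[abs_def] by measurable
  then show ?thesis using norm_charf_residual_le by (auto simp: multiplier_def)
qed

lemma norm_one_minus_charf_residual_le:
  assumes "0 \<le> t"
  shows "norm (1 - charf_residual t) \<le> t * max_step"
proof -
  have "1 - charf_residual t = (\<Sum>j\<in>J. complex_of_real (p j / mean) *
      (\<integral>s. complex_of_real (indicator {0..w j} s) * (1 - cis (- t * s)) \<partial>lborel))"
  proof -
    have i: "integrable lborel (\<lambda>s. complex_of_real (indicator {0..w j} s) * cis (- t * s))" for j
    proof -
      have "integrable lborel (\<lambda>s. indicator {0..w j} s *\<^sub>R cis (- t * s))"
        by (rule borel_integrable_compact) (auto intro!: continuous_intros)
      then show ?thesis by (simp add: scaleR_conv_of_real)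
    qed
    have "(\<integral>s. complex_of_real (indicator {0..w j} s) * (1 - cis (- t * s)) \<partial>lborel)
        = complex_of_real (w j) - (\<integral>s. complex_of_real (indicator {0..w j} s) * cis (- t * s) \<partial>lborel)"
      if "j \<in> J" for j
      using i[of j] w_pos[OF that] by (simp add: right_diff_distrib)
    then show ?thesis
      using arg_cong[OF sum_p_w_div_mean, of complex_of_real]
      by (simp add: charf_residual_def right_diff_distrib sum_subtractf)
  qed
  also have "norm \<dots> \<le> (\<Sum>j\<in>J. p j / mean * w j * (t * max_step))"
  proof (rule order_trans[OF norm_sum sum_mono])
    fix j assume j: "j \<in> J"
    have "norm (\<integral>s. complex_of_real (indicator {0..w j} s) * (1 - cis (- t * s)) \<partial>lborel)
        \<le> (\<integral>s. norm (complex_of_real (indicator {0..w j} s) * (1 - cis (- t * s))) \<partial>lborel)"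
      by (rule integral_norm_bound)
    also have "\<dots> \<le> (\<integral>s. indicator {0..w j} s * (t * max_step) \<partial>lborel)"
    proof (rule integral_mono_AE')
      show "integrable lborel (\<lambda>s. indicator {0..w j} s * (t * max_step))"
        using w_pos[OF j] by (intro integrable_mult_left integrable_real_indicator) auto
      have "norm (1 - cis (- t * s)) \<le> t * max_step" if "s \<in> {0..w j}" for s
      proof -
        have "norm (1 - cis (- t * s)) \<le> t * s" using norm_one_minus_cis_le[of "- t * s"] that assms by simp
        also have "\<dots> \<le> t * max_step" using that w_le_max_step[OF j] assms by (intro mult_left_mono) auto
        finally show ?thesis .
      qed
      then show "AE s in lborel. norm (complex_of_real (indicator {0..w j} s) * (1 - cis (- t * s)))
          \<le> indicator {0..w j} s * (t * max_step)"
        by (intro always_eventually allI) (auto simp: norm_mult indicator_def)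
      show "AE s in lborel. 0 \<le> indicator {0..w j} s * (t * max_step)"
        using assms max_step_pos by (intro always_eventually allI) auto
    qed
    also have "\<dots> = w j * (t * max_step)" using w_pos[OF j] by simp
    finally show "norm (complex_of_real (p j / mean) *
        (\<integral>s. complex_of_real (indicator {0..w j} s) * (1 - cis (- t * s)) \<partial>lborel))
        \<le> p j / mean * w j * (t * max_step)"
      using p_pos[OF j] mean_pos unfolding norm_mult norm_of_real mult.assoc by (intro mult_mono) auto
  qed
  also have "\<dots> = t * max_step" by (simp only: sum_distrib_right[symmetric] sum_p_w_div_mean mult_1)
  finally show ?thesis .
qed

text \<open>From \<open>\<bar>1 + z\<bar>\<^sup>2 \<le> 2 + 2 Re z\<close> for \<open>\<bar>z\<bar> \<le> 1\<close> and \<open>1 + x \<le> e\<^sup>x\<close>.\<close>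

lemma norm_lazy_power_le: "norm (lazy t) ^ (2 * n) \<le> exp (- real n * (1 - Re (charf t)) / 2)"
proof -
  have "(norm (lazy t))\<^sup>2 = ((1 + Re (charf t))\<^sup>2 + (Im (charf t))\<^sup>2) / 4"
    by (simp add: lazy_def cmod_power2 norm_divide power_divide)
  also have "\<dots> = (1 + 2 * Re (charf t) + (norm (charf t))\<^sup>2) / 4"
    unfolding cmod_power2 by (simp add: power2_eq_square algebra_simps)
  also have "\<dots> \<le> (1 + 2 * Re (charf t) + 1) / 4"
    using power_le_one[OF norm_ge_zero norm_charf_le[of t]] by (intro divide_right_mono) auto
  also have "\<dots> = 1 + (- (1 - Re (charf t)) / 2)" by (simp add: field_simps)
  also have "\<dots> \<le> exp (- (1 - Re (charf t)) / 2)" by (rule exp_ge_add_one_self)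
  finally have "((norm (lazy t))\<^sup>2) ^ n \<le> exp (- (1 - Re (charf t)) / 2) ^ n"
    by (intro power_mono) auto
  moreover have "exp (- (1 - Re (charf t)) / 2) ^ n = exp (- real n * (1 - Re (charf t)) / 2)"
    unfolding exp_of_nat_mult[symmetric] by (rule arg_cong[where f = exp]) (simp add: field_simps)
  ultimately show ?thesis by (simp only: power_mult)
qed

section \<open>The multipliers as averages in time\<close>

lemma integrable_indicator_Icc: "integrable lborel (\<lambda>s. indicator {a..b::real} s :: real)"
  by (cases "a \<le> b") (auto intro!: integrable_real_indicator)

lemma filtered_charf:
  assumes b: "integrable lborel b" and q: "multiplier q"
  shows "filtered T b (\<lambda>t. q t * charf t) y = (\<Sum>j\<in>J. p j * filtered T b q (y - w j))"
proof -
  have c: "multiplier (\<lambda>t. cis (- t * s))" for s by (auto simp: multiplier_def)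
  have "filtered T b (\<lambda>t. q t * charf t) y
      = filtered T b (\<lambda>t. \<Sum>j\<in>J. q t * cis (- t * w j) * complex_of_real (p j)) y"
    by (simp add: charf_def sum_distrib_left ac_simps)
  also have "\<dots> = (\<Sum>j\<in>J. p j * filtered T b q (y - w j))"
    by (subst filtered_sum[OF b], intro multiplier_intros c q) (simp only: filtered_cmult filtered_translation)
  finally show ?thesis .
qed

lemma filtered_charf_residual:
  assumes b: "integrable lborel b" and q: "multiplier q"
  shows "filtered T b (\<lambda>t. q t * charf_residual t) y
       = (\<Sum>j\<in>J. p j / mean * (\<integral>s. indicator {0..w j} s * filtered T b q (y - s) \<partial>lborel))"
proof -
  define e where "e j t = (\<integral>s. complex_of_real (indicator {0..w j} s) * cis (- t * s) \<partial>lborel)" for j t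
  have e: "multiplier (e j)" if "j \<in> J" for j
  proof -
    have "e j \<in> borel_measurable borel" unfolding e_def[abs_def] by measurable
    moreover have "norm (e j t) \<le> w j" for t
      unfolding e_def using w_pos[OF that] by (intro norm_integral_cis_le) simp
    ultimately show ?thesis by (auto simp: multiplier_def)
  qed
  let ?G = "\<lambda>t. complex_of_real (fejer_weight T t) * fourier b t * q t"
  let ?K = "\<lambda>j s. complex_of_real (indicator {0..w j} s)"
  have iK: "integrable lborel (?K j)" for j
    by (intro integrable_of_real integrable_indicator_Icc)
  have "filtered T b (\<lambda>t. q t * e j t) y = (\<integral>s. indicator {0..w j} s * filtered T b q (y - s) \<partial>lborel)" for j
  proof -
    have "(\<integral>t. ?G t * e j t * cis (t * y) \<partial>lborel)
        = (\<integral>t. ?G t * (\<integral>s. ?K j s * cis (t * (y - s)) \<partial>lborel) \<partial>lborel)"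
    proof (rule Bochner_Integration.integral_cong[OF refl])
      fix t
      have "(\<integral>s. ?K j s * cis (t * (y - s)) \<partial>lborel) = (\<integral>s. ?K j s * cis (- t * s) * cis (t * y) \<partial>lborel)"
        by (simp add: mult.assoc cis_mult right_diff_distrib)
      then show "?G t * e j t * cis (t * y) = ?G t * (\<integral>s. ?K j s * cis (t * (y - s)) \<partial>lborel)"
        by (simp only: e_def mult.assoc[of "?G t"] integral_mult_left_zero)
    qed
    also have "\<dots> = (\<integral>s. ?K j s * (\<integral>t. ?G t * cis (t * (y - s)) \<partial>lborel) \<partial>lborel)"
      by (intro swap_integrals[where B = 1] integrable_filtered[OF b q] iK) auto
    finally have "filtered T b (\<lambda>t. q t * e j t) y
        = Re (\<integral>s. ?K j s * (\<integral>t. ?G t * cis (t * (y - s)) \<partial>lborel) \<partial>lborel)"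
      unfolding filtered_def by (simp add: mult.assoc)
    also have "\<dots> = (\<integral>s. Re (?K j s * (\<integral>t. ?G t * cis (t * (y - s)) \<partial>lborel)) \<partial>lborel)"
      by (intro integral_Re[symmetric] integrable_swap_integrals[where B = 1]
          integrable_filtered[OF b q] iK) auto
    also have "\<dots> = (\<integral>s. indicator {0..w j} s * filtered T b q (y - s) \<partial>lborel)"
      by (simp add: filtered_def)
    finally show ?thesis .
  qed
  moreover have "filtered T b (\<lambda>t. q t * charf_residual t) y
      = filtered T b (\<lambda>t. \<Sum>j\<in>J. q t * e j t * complex_of_real (p j / mean)) y"
    by (simp add: charf_residual_def e_def sum_distrib_left ac_simps)
  moreover have "\<dots> = (\<Sum>j\<in>J. p j / mean * filtered T b (\<lambda>t. q t * e j t) y)"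
    by (subst filtered_sum[OF b], intro multiplier_intros q e, assumption) (simp only: filtered_cmult)
  ultimately show ?thesis by simp
qed

text \<open>Both averages look back by at most \<open>max_step\<close>. So a bound on a window survives an
  application of them, on a window shortened by \<open>max_step\<close> at its left end.\<close>

lemma abs_filtered_charf_le:
  assumes b: "integrable lborel b" and q: "multiplier q"
    and \<epsilon>: "\<And>z. y - max_step \<le> z \<Longrightarrow> z \<le> y \<Longrightarrow> \<bar>filtered T b q z\<bar> \<le> \<epsilon>"
  shows "\<bar>filtered T b (\<lambda>t. q t * charf t) y\<bar> \<le> \<epsilon>"
proof -
  have "\<bar>filtered T b (\<lambda>t. q t * charf t) y\<bar> \<le> (\<Sum>j\<in>J. p j * \<epsilon>)"
    unfolding filtered_charf[OF b q]
  proof (rule order_trans[OF sum_abs sum_mono])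
    fix j assume j: "j \<in> J"
    show "\<bar>p j * filtered T b q (y - w j)\<bar> \<le> p j * \<epsilon>"
      using p_pos[OF j] w_pos[OF j] w_le_max_step[OF j] \<epsilon>[of "y - w j"]
      by (simp add: abs_mult mult_left_mono)
  qed
  then show ?thesis by (simp add: sum_p flip: sum_distrib_right)
qed

lemma abs_residual_average_le:
  assumes \<epsilon>: "\<And>z. y - max_step \<le> z \<Longrightarrow> z \<le> y \<Longrightarrow> \<bar>g z\<bar> \<le> \<epsilon>"
  shows "\<bar>\<Sum>j\<in>J. p j / mean * (\<integral>s. indicator {0..w j} s * g (y - s) \<partial>lborel)\<bar> \<le> \<epsilon>"
proof -
  have "\<bar>\<Sum>j\<in>J. p j / mean * (\<integral>s. indicator {0..w j} s * g (y - s) \<partial>lborel)\<bar> \<le> (\<Sum>j\<in>J. p j / mean * w j * \<epsilon>)"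
  proof (rule order_trans[OF sum_abs sum_mono])
    fix j assume j: "j \<in> J"
    have e0: "0 \<le> \<epsilon>" using \<epsilon>[of y] max_step_pos by auto
    have "\<bar>\<integral>s. indicator {0..w j} s * g (y - s) \<partial>lborel\<bar>
        \<le> (\<integral>s. \<bar>indicator {0..w j} s * g (y - s)\<bar> \<partial>lborel)" by (rule integral_abs_bound)
    also have "\<dots> \<le> (\<integral>s. indicator {0..w j} s * \<epsilon> \<partial>lborel)"
    proof (rule integral_mono_AE')
      show "integrable lborel (\<lambda>s. indicator {0..w j} s * \<epsilon>)"
        by (intro integrable_mult_left integrable_indicator_Icc)
      have "\<bar>g (y - s)\<bar> \<le> \<epsilon>" if "s \<in> {0..w j}" for s
        using \<epsilon>[of "y - s"] that w_le_max_step[OF j] by auto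
      then show "AE s in lborel. \<bar>indicator {0..w j} s * g (y - s)\<bar> \<le> indicator {0..w j} s * \<epsilon>"
        by (intro always_eventually allI) (auto simp: indicator_def)
    qed (use e0 in auto)
    also have "\<dots> = w j * \<epsilon>" using w_pos[OF j] by simp
    finally have "\<bar>\<integral>s. indicator {0..w j} s * g (y - s) \<partial>lborel\<bar> \<le> w j * \<epsilon>" .
    then show "\<bar>p j / mean * (\<integral>s. indicator {0..w j} s * g (y - s) \<partial>lborel)\<bar> \<le> p j / mean * w j * \<epsilon>"
      using p_pos[OF j] mean_pos unfolding abs_mult mult.assoc by (intro mult_mono) auto
  qed
  also have "\<dots> = (\<Sum>j\<in>J. p j / mean * w j) * \<epsilon>" by (simp only: sum_distrib_right)
  finally show ?thesis by (simp only: sum_p_w_div_mean mult_1)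
qed

lemma abs_filtered_charf_residual_le:
  assumes b: "integrable lborel b" and q: "multiplier q"
    and \<epsilon>: "\<And>z. y - max_step \<le> z \<Longrightarrow> z \<le> y \<Longrightarrow> \<bar>filtered T b q z\<bar> \<le> \<epsilon>"
  shows "\<bar>filtered T b (\<lambda>t. q t * charf_residual t) y\<bar> \<le> \<epsilon>"
  unfolding filtered_charf_residual[OF b q] by (rule abs_residual_average_le[OF \<epsilon>])

lemma abs_filtered_lazy_le:
  assumes b: "integrable lborel b" and q: "multiplier q"
    and \<epsilon>: "\<And>z. y - max_step \<le> z \<Longrightarrow> z \<le> y \<Longrightarrow> \<bar>filtered T b q z\<bar> \<le> \<epsilon>"
  shows "\<bar>filtered T b (\<lambda>t. q t * lazy t) y\<bar> \<le> \<epsilon>"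
proof -
  have "(\<lambda>t. q t * lazy t) = (\<lambda>t. q t * complex_of_real (1 / 2) - q t * charf t * complex_of_real (- 1 / 2))"
    by (simp add: lazy_def fun_eq_iff field_simps)
  then have "filtered T b (\<lambda>t. q t * lazy t) y
      = filtered T b (\<lambda>t. q t * complex_of_real (1 / 2) - q t * charf t * complex_of_real (- 1 / 2)) y" by simp
  also have "\<dots> = 1 / 2 * filtered T b q y - (- 1 / 2) * filtered T b (\<lambda>t. q t * charf t) y"
    by (subst filtered_diff[OF b], (intro multiplier_intros multiplier_charf q)+) (simp only: filtered_cmult)
  finally have "filtered T b (\<lambda>t. q t * lazy t) y
      = 1 / 2 * filtered T b q y - (- 1 / 2) * filtered T b (\<lambda>t. q t * charf t) y" .
  moreover have "\<bar>filtered T b (\<lambda>t. q t * charf t) y\<bar> \<le> \<epsilon>" by (rule abs_filtered_charf_le[OF b q \<epsilon>])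
  ultimately show ?thesis using \<epsilon>[of y] max_step_pos by (simp add: abs_le_iff)
qed

lemma abs_filtered_one_minus_residual_le:
  assumes b: "integrable lborel b" and q: "multiplier q"
    and \<epsilon>: "\<And>z. y - max_step \<le> z \<Longrightarrow> z \<le> y \<Longrightarrow> \<bar>filtered T b q z\<bar> \<le> \<epsilon>"
  shows "\<bar>filtered T b (\<lambda>t. q t * (1 - charf_residual t)) y\<bar> \<le> 2 * \<epsilon>"
proof -
  have "filtered T b (\<lambda>t. q t * (1 - charf_residual t)) y
      = filtered T b q y - filtered T b (\<lambda>t. q t * charf_residual t) y"
    unfolding right_diff_distrib mult_1_right
    by (intro filtered_diff[OF b] multiplier_intros multiplier_charf_residual q)
  moreover have "\<bar>filtered T b (\<lambda>t. q t * charf_residual t) y\<bar> \<le> \<epsilon>"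
    by (rule abs_filtered_charf_residual_le[OF b q \<epsilon>])
  ultimately show ?thesis using \<epsilon>[of y] max_step_pos by (simp add: abs_le_iff)
qed

text \<open>Writing \<open>\<chi> = 1 - \<rho>\<close> and \<open>\<lambda> = (1 + \<phi>)/2\<close>, the identities \<open>\<chi>\<^sup>k - \<chi>\<^bsup>k+1\<^esup> = \<rho> \<chi>\<^sup>k\<close> and
  \<open>\<lambda>\<^sup>n - \<lambda>\<^bsup>n+1\<^esup> = (1 - \<phi>) \<lambda>\<^sup>n / 2\<close> show that replacing the symbol 1 by \<open>\<chi>\<^sup>k \<lambda>\<^sup>n\<close> costs a sum of terms in which
  \<open>\<rho>\<close> or \<open>1 - \<phi>\<close> occurs. Those two symbols have small output by assumption; each factor \<open>\<chi>\<close>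
  at most doubles a bound and a factor \<open>\<lambda>\<close> preserves it.\<close>

lemma abs_filtered_one_le:
  assumes b: "integrable lborel b"
    and e1: "\<And>z. x0 \<le> z \<Longrightarrow> z \<le> x1 \<Longrightarrow> \<bar>filtered T b (\<lambda>t. 1 - charf t) z\<bar> \<le> \<epsilon>"
    and e2: "\<And>z. x0 \<le> z \<Longrightarrow> z \<le> x1 \<Longrightarrow> \<bar>filtered T b charf_residual z\<bar> \<le> \<epsilon>"
    and y: "x0 + real (k + n) * max_step \<le> y" "y \<le> x1"
  shows "\<bar>filtered T b (\<lambda>_. 1) y\<bar>
    \<le> 2 ^ k * (1 + real n) * \<epsilon> + \<bar>filtered T b (\<lambda>t. (1 - charf_residual t) ^ k * lazy t ^ n) y\<bar>"
proof -
  let ?\<chi> = "\<lambda>t. 1 - charf_residual t"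
  have m: "multiplier ?\<chi>" "multiplier lazy" "multiplier charf" "multiplier charf_residual"
    by (intro multiplier_intros multiplier_charf_residual multiplier_lazy multiplier_charf)+
  note mi = multiplier_intros m
  have step1: "\<bar>filtered T b (\<lambda>t. q t * ?\<chi> t ^ k) z\<bar> \<le> 2 ^ k * \<epsilon>'"
    if q: "multiplier q" and "\<And>z. x0 \<le> z \<Longrightarrow> z \<le> x1 \<Longrightarrow> \<bar>filtered T b q z\<bar> \<le> \<epsilon>'"
      "x0 + real k * max_step \<le> z" "z \<le> x1" for q k z \<epsilon>'
    using that(3,4)
  proof (induction k arbitrary: z)
    case (Suc k)
    have "\<bar>filtered T b (\<lambda>t. q t * ?\<chi> t ^ k * ?\<chi> t) z\<bar> \<le> 2 * (2 ^ k * \<epsilon>')"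
      using Suc.prems by (intro abs_filtered_one_minus_residual_le[OF b] Suc.IH mi q) (auto simp: algebra_simps)
    then show ?case by (simp add: ac_simps)
  qed (use that(2) in simp)
  have step2: "\<bar>filtered T b (\<lambda>t. q t * lazy t ^ n) z\<bar> \<le> \<epsilon>'"
    if q: "multiplier q" and "\<And>z. x0' \<le> z \<Longrightarrow> z \<le> x1 \<Longrightarrow> \<bar>filtered T b q z\<bar> \<le> \<epsilon>'"
      "x0' + real n * max_step \<le> z" "z \<le> x1" for q n z \<epsilon>' x0'
    using that(3,4)
  proof (induction n arbitrary: z)
    case (Suc n)
    have "\<bar>filtered T b (\<lambda>t. q t * lazy t ^ n * lazy t) z\<bar> \<le> \<epsilon>'"
      using Suc.prems by (intro abs_filtered_lazy_le[OF b] Suc.IH mi q) (auto simp: algebra_simps)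
    then show ?case by (simp add: ac_simps)
  qed (use that(2) in simp)
  have W: "0 < max_step" by (rule max_step_pos)
  have e0: "0 \<le> \<epsilon>"
  proof -
    have "0 \<le> real (k + n) * max_step" using W by simp
    then show ?thesis using e1[of y] y by linarith
  qed
  have A: "\<bar>filtered T b (\<lambda>_. 1) z - filtered T b (\<lambda>t. ?\<chi> t ^ k) z\<bar> \<le> (2 ^ k - 1) * \<epsilon>"
    if "x0 + real k * max_step \<le> z" "z \<le> x1" for k z
    using that
  proof (induction k)
    case (Suc k)
    have z: "x0 + real k * max_step \<le> z" using Suc.prems W by (simp add: algebra_simps)
    have "filtered T b (\<lambda>t. ?\<chi> t ^ k) z - filtered T b (\<lambda>t. ?\<chi> t ^ Suc k) z
        = filtered T b (\<lambda>t. ?\<chi> t ^ k - ?\<chi> t ^ Suc k) z"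
      by (intro filtered_diff[OF b, symmetric] mi)
    also have "(\<lambda>t. ?\<chi> t ^ k - ?\<chi> t ^ Suc k) = (\<lambda>t. charf_residual t * ?\<chi> t ^ k)"
      by (simp add: fun_eq_iff algebra_simps)
    finally have eq: "filtered T b (\<lambda>t. ?\<chi> t ^ k) z - filtered T b (\<lambda>t. ?\<chi> t ^ Suc k) z
        = filtered T b (\<lambda>t. charf_residual t * ?\<chi> t ^ k) z" .
    have "\<bar>filtered T b (\<lambda>t. charf_residual t * ?\<chi> t ^ k) z\<bar> \<le> 2 ^ k * \<epsilon>"
      by (rule step1[OF m(4) e2 z]) (use Suc.prems in auto)
    then have "\<bar>filtered T b (\<lambda>t. ?\<chi> t ^ k) z - filtered T b (\<lambda>t. ?\<chi> t ^ Suc k) z\<bar> \<le> 2 ^ k * \<epsilon>" unfolding eq .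
    moreover have "(2 ^ Suc k - 1) * \<epsilon> = (2 ^ k - 1) * \<epsilon> + 2 ^ k * \<epsilon>" by (simp add: algebra_simps)
    ultimately show ?case using Suc.IH[OF z Suc.prems(2)] by linarith
  qed simp
  have B: "\<bar>filtered T b (\<lambda>t. ?\<chi> t ^ k) y - filtered T b (\<lambda>t. ?\<chi> t ^ k * lazy t ^ n) y\<bar> \<le> real n * 2 ^ k * \<epsilon>"
    if "x0 + real (k + n) * max_step \<le> y" for n
    using that
  proof (induction n)
    case (Suc n)
    have yn: "x0 + real (k + n) * max_step \<le> y" using Suc.prems W by (simp add: algebra_simps)
    let ?q = "\<lambda>t. (1 - charf t) * ?\<chi> t ^ k"
    have "filtered T b (\<lambda>t. ?\<chi> t ^ k * lazy t ^ n) y - filtered T b (\<lambda>t. ?\<chi> t ^ k * lazy t ^ Suc n) y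
        = filtered T b (\<lambda>t. ?\<chi> t ^ k * lazy t ^ n - ?\<chi> t ^ k * lazy t ^ Suc n) y"
      by (intro filtered_diff[OF b, symmetric] mi)
    also have "(\<lambda>t. ?\<chi> t ^ k * lazy t ^ n - ?\<chi> t ^ k * lazy t ^ Suc n)
        = (\<lambda>t. ?q t * lazy t ^ n * complex_of_real (1 / 2))"
      by (simp add: fun_eq_iff lazy_def field_simps)
    also have "filtered T b \<dots> y = 1 / 2 * filtered T b (\<lambda>t. ?q t * lazy t ^ n) y"
      by (rule filtered_cmult)
    finally have eq: "filtered T b (\<lambda>t. ?\<chi> t ^ k * lazy t ^ n) y - filtered T b (\<lambda>t. ?\<chi> t ^ k * lazy t ^ Suc n) y
        = 1 / 2 * filtered T b (\<lambda>t. ?q t * lazy t ^ n) y" .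
    have "\<bar>filtered T b (\<lambda>t. ?q t * lazy t ^ n) y\<bar> \<le> 2 ^ k * \<epsilon>"
    proof (rule step2[where x0' = "x0 + real k * max_step"])
      show "multiplier ?q" by (intro mi)
      show "\<bar>filtered T b ?q z\<bar> \<le> 2 ^ k * \<epsilon>" if "x0 + real k * max_step \<le> z" "z \<le> x1" for z
        by (rule step1[OF _ e1 that]) (intro mi)
      show "x0 + real k * max_step + real n * max_step \<le> y" using yn by (simp add: algebra_simps)
    qed (rule y)
    then have "\<bar>filtered T b (\<lambda>t. ?\<chi> t ^ k * lazy t ^ n) y - filtered T b (\<lambda>t. ?\<chi> t ^ k * lazy t ^ Suc n) y\<bar>
        \<le> 2 ^ k * \<epsilon>" unfolding eq by linarith
    moreover have "real (Suc n) * 2 ^ k * \<epsilon> = real n * 2 ^ k * \<epsilon> + 2 ^ k * \<epsilon>" by (simp add: algebra_simps)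
    ultimately show ?case using Suc.IH[OF yn] by linarith
  qed simp
  have "real k * max_step \<le> real (k + n) * max_step" using W by (intro mult_right_mono) auto
  then have "x0 + real k * max_step \<le> y" using y(1) by linarith
  note A[OF this y(2)] B[OF y(1)]
  moreover have "2 ^ k * (1 + real n) * \<epsilon> = (2 ^ k - 1) * \<epsilon> + \<epsilon> + real n * 2 ^ k * \<epsilon>"
    by (simp add: algebra_simps)
  ultimately show ?thesis using e0 by linarith
qed

lemma filtered_one_minus_charf:
  assumes T: "0 < T" and b: "integrable lborel b" and C: "\<And>v. \<bar>b v\<bar> \<le> C"
  shows "filtered T b (\<lambda>t. 1 - charf t) y
       = (\<integral>u. (b (y - u) - (\<Sum>j\<in>J. p j * b (y - u - w j))) * fejer T u \<partial>lborel)"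
proof -
  have [measurable]: "b \<in> borel_measurable borel" using b by auto
  have i: "integrable lborel (\<lambda>u. b (z - u) * fejer T u)" for z
    by (rule integrable_bounded_fejer[OF T _ C]) measurable
  have i': "integrable lborel (\<lambda>u. p j * (b (y - w j - u) * fejer T u))" for j
    by (intro integrable_mult_right i)
  have "filtered T b (\<lambda>t. 1 - 1 * charf t) y
      = filtered T b (\<lambda>_. 1) y - (\<Sum>j\<in>J. p j * filtered T b (\<lambda>_. 1) (y - w j))"
    by (subst filtered_diff[OF b], (intro multiplier_intros multiplier_charf)+)
      (simp only: filtered_charf[OF b multiplier_const])
  also have "\<dots> = (\<integral>u. b (y - u) * fejer T u \<partial>lborel)
      - (\<integral>u. (\<Sum>j\<in>J. p j * (b (y - w j - u) * fejer T u)) \<partial>lborel)"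
    using i' by (simp add: filtered_one[OF T b] Bochner_Integration.integral_sum)
  also have "\<dots> = (\<integral>u. b (y - u) * fejer T u - (\<Sum>j\<in>J. p j * (b (y - w j - u) * fejer T u)) \<partial>lborel)"
    using i i' by (intro Bochner_Integration.integral_diff[symmetric] Bochner_Integration.integrable_sum) auto
  also have "\<dots> = (\<integral>u. (b (y - u) - (\<Sum>j\<in>J. p j * b (y - u - w j))) * fejer T u \<partial>lborel)"
    by (simp add: left_diff_distrib sum_distrib_right mult.assoc cancel_ab_semigroup_add_class.diff_right_commute[of y])
  finally show ?thesis by simp
qed

lemma filtered_residual_eq:
  assumes T: "0 < T" and b: "integrable lborel b" and C: "\<And>v. \<bar>b v\<bar> \<le> C"
  shows "filtered T b charf_residual y
       = (\<integral>u. (\<Sum>j\<in>J. p j / mean * (\<integral>s. indicator {0..w j} s * b (y - u - s) \<partial>lborel)) * fejer T u \<partial>lborel)"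
proof -
  have [measurable]: "b \<in> borel_measurable borel" using b by auto
  have sw: "(\<integral>s. indicator {0..w j} s * (\<integral>u. fejer T u * b (y - s - u) \<partial>lborel) \<partial>lborel)
        = (\<integral>u. fejer T u * (\<integral>s. indicator {0..w j} s * b (y - s - u) \<partial>lborel) \<partial>lborel)" (is ?eq)
    and i: "integrable lborel (\<lambda>u. fejer T u * (\<integral>s. indicator {0..w j} s * b (y - s - u) \<partial>lborel))" (is ?int) for j
  proof -
    have m: "(\<lambda>(u, s). b (y - s - u)) \<in> borel_measurable (borel \<Otimes>\<^sub>M borel)" by measurable
    have c: "norm (b (y - s - u)) \<le> C" for u s using C by simp
    show ?eq by (rule swap_integrals[OF integrable_fejer[OF T] integrable_indicator_Icc m c])
    show ?int by (rule integrable_swap_integrals[OF integrable_fejer[OF T] integrable_indicator_Icc m c])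
  qed
  have "filtered T b (\<lambda>t. 1 * charf_residual t) y
      = (\<Sum>j\<in>J. p j / mean * (\<integral>s. indicator {0..w j} s * filtered T b (\<lambda>_. 1) (y - s) \<partial>lborel))"
    by (rule filtered_charf_residual[OF b multiplier_const])
  also have "\<dots> = (\<Sum>j\<in>J. p j / mean * (\<integral>u. fejer T u * (\<integral>s. indicator {0..w j} s * b (y - s - u) \<partial>lborel) \<partial>lborel))"
    by (simp only: filtered_one[OF T b] sw[symmetric] mult.commute[of "fejer T _" "b _"])
  also have "\<dots> = (\<integral>u. (\<Sum>j\<in>J. p j / mean * (fejer T u * (\<integral>s. indicator {0..w j} s * b (y - s - u) \<partial>lborel))) \<partial>lborel)"
    using i by (subst Bochner_Integration.integral_sum) (auto simp del: times_divide_eq_left)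
  also have "\<dots> = (\<integral>u. (\<Sum>j\<in>J. p j / mean * (\<integral>s. indicator {0..w j} s * b (y - u - s) \<partial>lborel)) * fejer T u \<partial>lborel)"
    by (simp add: sum_distrib_left ac_simps cancel_ab_semigroup_add_class.diff_right_commute[of y])
  finally show ?thesis by simp
qed

section \<open>A renewal theorem with a rate\<close>

text \<open>For small \<open>t\<close> the factor \<open>O(t)\<close> of each \<open>1 - charf_residual t\<close> is used against
  \<open>exp (- n c t\<^sup>2 / 2)\<close>, which gives a power \<open>n\<^bsup>-r\<^esup>\<close>. For larger \<open>t\<close> the lazy factor alone is small.\<close>

lemma norm_multiplier_power_le:
  assumes c: "0 < c" and \<kappa>: "0 < \<kappa>"
    and dioph: "\<And>t. 0 < t \<Longrightarrow> c * min (t\<^sup>2) (t powr - \<kappa>) \<le> 1 - Re (charf t)"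
    and t: "0 \<le> t" "t \<le> T" and n: "1 \<le> n" and r: "1 \<le> r"
  shows "norm ((1 - charf_residual t) ^ (2 * r) * lazy t ^ (2 * n))
    \<le> max_step ^ (2 * r) * (2 * real r / (real n * c)) ^ r
       + 4 ^ r * exp (- real n * c * T powr - \<kappa> / 2)" (is "_ \<le> ?A + ?B")
proof -
  have nonneg: "0 \<le> ?A" "0 \<le> ?B" using c max_step_pos by simp_all
  let ?z = "norm (1 - charf_residual t)"
  have z: "?z \<le> t * max_step" "?z \<le> 2"
    using norm_one_minus_charf_residual_le[OF t(1)] norm_triangle_ineq4[of 1 "charf_residual t"]
      norm_charf_residual_le[of t] by auto
  have eq: "norm ((1 - charf_residual t) ^ (2 * r) * lazy t ^ (2 * n)) = ?z ^ (2 * r) * norm (lazy t) ^ (2 * n)"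
    by (simp add: norm_mult norm_power)
  show ?thesis
  proof (cases "t = 0")
    case True
    then have "?z = 0" using z(1) by simp
    then show ?thesis using nonneg r unfolding eq by (simp add: zero_power)
  next
    case False
    then have t0: "0 < t" using t by simp
    have lz: "norm (lazy t) ^ (2 * n) \<le> exp (- real n * c * m / 2)"
      if "c * m \<le> 1 - Re (charf t)" for m
      using order_trans[OF norm_lazy_power_le[of t n]] mult_left_mono[OF that, of "real n"]
      by (simp add: mult.assoc)
    show ?thesis
    proof (cases "t\<^sup>2 \<le> t powr - \<kappa>")
      case True
      then have "c * t\<^sup>2 \<le> 1 - Re (charf t)" using dioph[OF t0] by (simp add: min_def)
      note lz = lz[OF this]
      define x where "x = real n * c * t\<^sup>2 / 2"
      have "?z ^ (2 * r) * norm (lazy t) ^ (2 * n) \<le> (t * max_step) ^ (2 * r) * exp (- real n * c * t\<^sup>2 / 2)"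
        using z(1) lz by (intro mult_mono power_mono) auto
      also have "(t * max_step) ^ (2 * r) = max_step ^ (2 * r) * (t\<^sup>2) ^ r"
        by (simp add: power_mult_distrib power_mult)
      also have "t\<^sup>2 = 2 / (real n * c) * x" using c n by (simp add: x_def field_simps)
      also have "max_step ^ (2 * r) * (2 / (real n * c) * x) ^ r * exp (- real n * c * (2 / (real n * c) * x) / 2)
          = max_step ^ (2 * r) * (2 / (real n * c)) ^ r * (x ^ r * exp (- x))"
      proof -
        have "- real n * c * (2 / (real n * c) * x) / 2 = - x" using c n by (simp add: field_simps)
        then show ?thesis unfolding power_mult_distrib[of _ x] by (simp only: mult.assoc)
      qed
      also have "\<dots> \<le> max_step ^ (2 * r) * (2 / (real n * c)) ^ r * real r ^ r"
        using c n r max_step_pos by (intro mult_left_mono power_mult_exp_minus_le) (auto simp: x_def)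
      also have "\<dots> = ?A" by (simp add: power_mult_distrib[symmetric] mult.assoc)
      finally show ?thesis using nonneg unfolding eq by linarith
    next
      case False
      then have "c * t powr - \<kappa> \<le> 1 - Re (charf t)" using dioph[OF t0] by (simp add: min_def)
      moreover have "T powr - \<kappa> \<le> t powr - \<kappa>" using t0 t \<kappa> by (intro powr_mono2') auto
      ultimately have "c * T powr - \<kappa> \<le> 1 - Re (charf t)"
        using c by (meson mult_left_mono order_trans less_imp_le)
      note lz = lz[OF this]
      have "?z ^ (2 * r) * norm (lazy t) ^ (2 * n) \<le> 2 ^ (2 * r) * exp (- real n * c * T powr - \<kappa> / 2)"
        using z(2) lz by (intro mult_mono power_mono) auto
      also have "\<dots> = ?B" by (simp add: power_mult)
      finally show ?thesis using nonneg unfolding eq by linarith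
    qed
  qed
qed

text \<open>The quantitative form for one fixed \<open>Y\<close>. The hypotheses \<open>renewal\<close> and \<open>residual\<close> say that
  \<open>a - Pa\<close> and \<open>Qa\<close> decay exponentially; in the conclusion, the summands stand in turn for these
  defects, for the frequencies up to \<open>T\<close>, and for the passage from the Fejer average back to
  the value of \<open>a\<close> at \<open>Y\<close>.\<close>

lemma abs_le_of_small_defects:
  assumes a[measurable]: "a \<in> borel_measurable borel" and a_neg: "\<And>v. v < 0 \<Longrightarrow> a v = 0"
    and C: "\<And>v. \<bar>a v\<bar> \<le> C"
    and slow: "\<And>v v'. 0 \<le> v \<Longrightarrow> v \<le> v' \<Longrightarrow> a v - C * (v' - v) \<le> a v'"
    and D: "0 < D"
    and renewal: "\<And>v. 0 \<le> v \<Longrightarrow> \<bar>a v - (\<Sum>j\<in>J. p j * a (v - w j))\<bar> \<le> C * exp (- D * v)"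
    and residual: "\<And>v. 0 \<le> v \<Longrightarrow>
      \<bar>\<Sum>j\<in>J. p j / mean * (\<integral>s. indicator {0..w j} s * a (v - s) \<partial>lborel)\<bar> \<le> C * exp (- D * v)"
    and Y: "4 \<le> Y" and T: "0 < T" and \<eta>: "0 < \<eta>" "\<eta> \<le> 1"
    and steps: "real (2 * r + 2 * n) * max_step \<le> Y / 2 - 1"
    and \<delta>: "\<And>t. t \<in> {0..T} \<Longrightarrow> norm ((1 - charf_residual t) ^ (2 * r) * lazy t ^ (2 * n)) \<le> \<delta>"
  shows "\<bar>a Y\<bar> \<le> 4 ^ r * (1 + 2 * real n) * (C * exp (- D * (Y / 4)) + 64 * C / fejer_mass / (T * Y))
      + 2 * C * Y * T / fejer_mass * \<delta> + 2 * C * \<eta> + 8 * C / fejer_mass / (T * \<eta>)"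
proof -
  have C0: "0 \<le> C" using C[of 0] by linarith
  \<comment> \<open>Truncation makes the Fourier transform of \<open>a\<close> exist. The averages look into the past only, so the
  defects of \<open>b\<close> agree with those of \<open>a\<close> up to \<open>2 * Y\<close>.\<close>
  define b where "b v = indicator {0..2 * Y} v * a v" for v
  have b_eq: "b v = a v" if "v \<le> 2 * Y" for v using that a_neg[of v] by (auto simp: b_def indicator_def)
  have [measurable]: "b \<in> borel_measurable borel" unfolding b_def by measurable
  have bC: "\<bar>b v\<bar> \<le> C" for v using C[of v] C0 by (auto simp: b_def indicator_def)
  have ib: "integrable lborel (\<lambda>v. indicator {0..2 * Y} v * C)"
    by (intro integrable_mult_left integrable_indicator_Icc)
  have b_le: "\<bar>b v\<bar> \<le> indicator {0..2 * Y} v * C" for v using C[of v] by (auto simp: b_def indicator_def)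
  have b: "integrable lborel b"
    by (rule Bochner_Integration.integrable_bound[OF ib]) (use b_le C0 in \<open>auto simp: abs_mult\<close>)
  have "(\<integral>v. \<bar>b v\<bar> \<partial>lborel) \<le> (\<integral>v. indicator {0..2 * Y} v * C \<partial>lborel)"
    using b_le by (intro integral_mono integrable_abs b ib)
  then have b1: "(\<integral>v. \<bar>b v\<bar> \<partial>lborel) \<le> 2 * Y * C" using Y by simp
  let ?h1 = "\<lambda>v. b v - (\<Sum>j\<in>J. p j * b (v - w j))"
  let ?h2 = "\<lambda>v. \<Sum>j\<in>J. p j / mean * (\<integral>s. indicator {0..w j} s * b (v - s) \<partial>lborel)"
  let ?\<epsilon> = "C * exp (- D * (Y / 4)) + 64 * C / fejer_mass / (T * Y)"
  have eps: "\<bar>\<integral>u. h (z - u) * fejer T u \<partial>lborel\<bar> \<le> ?\<epsilon>"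
    if [measurable]: "h \<in> borel_measurable borel" and hC: "\<And>v. \<bar>h v\<bar> \<le> 2 * C"
      and hD: "\<And>v. 0 \<le> v \<Longrightarrow> v \<le> 2 * Y \<Longrightarrow> \<bar>h v\<bar> \<le> C * exp (- D * v)"
      and z: "Y / 2 \<le> z" "z \<le> Y + 1" for h z
  proof -
    have "\<bar>\<integral>u. h (z - u) * fejer T u \<partial>lborel\<bar> \<le> C * exp (- D * (Y / 4)) + 8 * (2 * C) / fejer_mass / (T * (Y / 4))"
    proof (rule fejer_average_abs_le[OF T])
      fix u assume u: "\<bar>u\<bar> \<le> Y / 4"
      then have "\<bar>h (z - u)\<bar> \<le> C * exp (- D * (z - u))" using z Y by (intro hD) (auto simp: abs_le_iff)
      also have "\<dots> \<le> C * exp (- D * (Y / 4))"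
        using u z Y D C0 by (intro mult_left_mono) (auto simp: abs_le_iff)
      finally show "\<bar>h (z - u)\<bar> \<le> C * exp (- D * (Y / 4))" .
    qed (use Y hC in auto)
    also have "8 * (2 * C) / fejer_mass / (T * (Y / 4)) = 64 * C / fejer_mass / (T * Y)" by simp
    finally show ?thesis .
  qed
  have e1: "\<bar>filtered T b (\<lambda>t. 1 - charf t) z\<bar> \<le> ?\<epsilon>" if "Y / 2 \<le> z" "z \<le> Y + 1" for z
    unfolding filtered_one_minus_charf[OF T b bC]
  proof (rule eps[where h = ?h1, OF _ _ _ that])
    show "\<bar>?h1 v\<bar> \<le> 2 * C" for v
    proof -
      have "\<bar>\<Sum>j\<in>J. p j * b (v - w j)\<bar> \<le> (\<Sum>j\<in>J. p j * C)"
        using less_imp_le[OF p_pos] bC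
        by (intro order_trans[OF sum_abs sum_mono]) (auto simp: abs_mult intro!: mult_mono)
      also have "\<dots> = C" by (simp add: sum_p flip: sum_distrib_right)
      finally show ?thesis using bC[of v] by linarith
    qed
    show "\<bar>?h1 v\<bar> \<le> C * exp (- D * v)" if v: "0 \<le> v" "v \<le> 2 * Y" for v
    proof -
      have "?h1 v = a v - (\<Sum>j\<in>J. p j * a (v - w j))"
      proof (intro arg_cong2[where f = "(-)"] sum.cong refl)
        show "p j * b (v - w j) = p j * a (v - w j)" if "j \<in> J" for j
          using v w_pos[OF that] by (simp add: b_eq)
      qed (use v in \<open>simp add: b_eq\<close>)
      then show ?thesis using renewal[OF v(1)] by simp
    qed
  qed measurable
  have e2: "\<bar>filtered T b charf_residual z\<bar> \<le> ?\<epsilon>" if "Y / 2 \<le> z" "z \<le> Y + 1" for z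
    unfolding filtered_residual_eq[OF T b bC]
  proof (rule eps[where h = ?h2, OF _ _ _ that])
    show "\<bar>?h2 v\<bar> \<le> 2 * C" for v
    proof (rule abs_residual_average_le)
      show "\<bar>b z\<bar> \<le> 2 * C" for z using bC[of z] C0 by linarith
    qed
    show "\<bar>?h2 v\<bar> \<le> C * exp (- D * v)" if v: "0 \<le> v" "v \<le> 2 * Y" for v
    proof -
      have "indicator {0..w j} s * b (v - s) = indicator {0..w j} s * a (v - s)" for j s
        using v by (cases "s \<in> {0..w j}") (auto simp: b_eq)
      then show ?thesis using residual[OF v(1)] by (simp only:)
    qed
  qed measurable
  define G where "G = 4 ^ r * (1 + 2 * real n) * ?\<epsilon> + 2 * C * Y * T / fejer_mass * \<delta>"
  have d0: "0 \<le> \<delta>" by (rule order_trans[OF norm_ge_zero \<delta>[of 0]]) (use T in simp)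
  have F: "\<bar>\<integral>u. b (y - u) * fejer T u \<partial>lborel\<bar> \<le> G" if y: "Y - 1 \<le> y" "y \<le> Y + 1" for y
  proof -
    have "\<bar>filtered T b (\<lambda>_. 1) y\<bar> \<le> 2 ^ (2 * r) * (1 + real (2 * n)) * ?\<epsilon>
        + \<bar>filtered T b (\<lambda>t. (1 - charf_residual t) ^ (2 * r) * lazy t ^ (2 * n)) y\<bar>"
      using steps y by (intro abs_filtered_one_le[where ?x0.0 = "Y / 2" and ?x1.0 = "Y + 1", OF b e1 e2]) auto
    also have "\<bar>filtered T b (\<lambda>t. (1 - charf_residual t) ^ (2 * r) * lazy t ^ (2 * n)) y\<bar>
        \<le> T / fejer_mass * (\<integral>v. \<bar>b v\<bar> \<partial>lborel) * \<delta>"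
      by (intro abs_filtered_le[OF T b] \<delta> multiplier_intros multiplier_charf_residual multiplier_lazy)
    also have "\<dots> \<le> T / fejer_mass * (2 * Y * C) * \<delta>"
      using T fejer_mass_pos d0 b1 by (intro mult_right_mono mult_left_mono) auto
    finally show ?thesis
      unfolding filtered_one[OF T b] G_def power_mult[of "2::real" 2 r] by (simp add: ac_simps)
  qed
  \<comment> \<open>Since \<open>a\<close> can decrease only slowly, \<open>a Y\<close> is nearly a lower bound for \<open>a\<close> just after \<open>Y\<close> and an upper
  bound just before \<open>Y\<close>; so the averages are centred at \<open>Y + \<eta>\<close> and at \<open>Y - \<eta>\<close>.\<close>
  have "a Y - 2 * C * \<eta> - 8 * C / fejer_mass / (T * \<eta>) \<le> (\<integral>u. b (Y + \<eta> - u) * fejer T u \<partial>lborel)"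
  proof (rule fejer_average_ge[OF T \<eta>(1) _ bC])
    fix u assume u: "\<bar>u\<bar> \<le> \<eta>"
    then have "a Y - C * (Y + \<eta> - u - Y) \<le> a (Y + \<eta> - u)" using Y by (intro slow) auto
    moreover have "C * (Y + \<eta> - u - Y) \<le> C * (2 * \<eta>)" using u C0 by (intro mult_left_mono) auto
    ultimately show "a Y - 2 * C * \<eta> \<le> b (Y + \<eta> - u)" using u Y \<eta> by (subst b_eq) auto
  next
    show "a Y - 2 * C * \<eta> \<le> C" using C[of Y] C0 \<eta> mult_nonneg_nonneg[of C \<eta>] by linarith
  qed measurable
  moreover have "(\<integral>u. b (Y - \<eta> - u) * fejer T u \<partial>lborel) \<le> a Y + 2 * C * \<eta> + 8 * C / fejer_mass / (T * \<eta>)"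
  proof (rule fejer_average_le[OF T \<eta>(1) _ bC])
    fix u assume u: "\<bar>u\<bar> \<le> \<eta>"
    then have "a (Y - \<eta> - u) - C * (Y - (Y - \<eta> - u)) \<le> a Y" using Y \<eta> by (intro slow) auto
    moreover have "C * (Y - (Y - \<eta> - u)) \<le> C * (2 * \<eta>)" using u C0 by (intro mult_left_mono) auto
    ultimately show "b (Y - \<eta> - u) \<le> a Y + 2 * C * \<eta>" using u Y \<eta> by (subst b_eq) auto
  next
    show "- C \<le> a Y + 2 * C * \<eta>" using C[of Y] C0 \<eta> mult_nonneg_nonneg[of C \<eta>] by linarith
  qed measurable
  moreover have "\<bar>\<integral>u. b (Y + \<eta> - u) * fejer T u \<partial>lborel\<bar> \<le> G" "\<bar>\<integral>u. b (Y - \<eta> - u) * fejer T u \<partial>lborel\<bar> \<le> G"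
    using \<eta> by (intro F; simp)+
  ultimately show ?thesis unfolding G_def by (simp only: abs_le_iff) linarith
qed

text \<open>The parameters in the previous bound are \<open>T\<^sup>\<kappa> = c1 * Y / ln Y\<close> and \<open>\<eta> = T\<^bsup>-1/2\<^esup>\<close>, while \<open>n\<close> is of order \<open>Y\<close>. The
  constant \<open>c1\<close> is such that the lazy factor is at most \<open>Y\<^bsup>-r\<^esup>\<close> up to \<open>T\<close>, and the fixed exponent \<open>r\<close> is so large
  that \<open>T Y\<^bsup>1-r\<^esup> \<le> \<eta>\<close>. All terms are then \<open>O(\<eta>)\<close>.\<close>

theorem renewal_rate:
  assumes a: "a \<in> borel_measurable borel" and a_neg: "\<And>v. v < 0 \<Longrightarrow> a v = 0"
    and C: "\<And>v. \<bar>a v\<bar> \<le> C"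
    and slow: "\<And>v v'. 0 \<le> v \<Longrightarrow> v \<le> v' \<Longrightarrow> a v - C * (v' - v) \<le> a v'"
    and D: "0 < D"
    and renewal: "\<And>v. 0 \<le> v \<Longrightarrow> \<bar>a v - (\<Sum>j\<in>J. p j * a (v - w j))\<bar> \<le> C * exp (- D * v)"
    and residual: "\<And>v. 0 \<le> v \<Longrightarrow>
      \<bar>\<Sum>j\<in>J. p j / mean * (\<integral>s. indicator {0..w j} s * a (v - s) \<partial>lborel)\<bar> \<le> C * exp (- D * v)"
    and c: "0 < c" and \<kappa>: "0 < \<kappa>"
    and dioph: "\<And>t. 0 < t \<Longrightarrow> c * min (t\<^sup>2) (t powr - \<kappa>) \<le> 1 - Re (charf t)"
  shows "a \<in> O(\<lambda>y. (ln y / y) powr (1 / (2 * \<kappa>)))"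
proof -
  have C0: "0 \<le> C" using C[of 0] by linarith
  note fm = fejer_mass_pos and W = max_step_pos
  define \<theta> where "\<theta> = 1 / (2 * \<kappa>)"
  have \<theta>: "0 < \<theta>" "2 * \<theta> * \<kappa> = 1" using \<kappa> by (auto simp: \<theta>_def)
  define r where "r = nat \<lceil>2 + 3 * \<theta>\<rceil>"
  have r: "3 * \<theta> \<le> real r - 1" "1 \<le> r" using \<theta> unfolding r_def by linarith+
  define c1 where "c1 = c / (64 * max_step * real r)"
  have c1: "0 < c1" using c W r by (simp add: c1_def)
  define B where "B = max_step ^ (2 * r) * (64 * max_step * real r / c) ^ r + 4 ^ r"
  have B: "0 \<le> B" unfolding B_def using W c by simp
  define N where "N = 1 + 1 / (8 * max_step)"
  have N: "0 \<le> N" using W by (simp add: N_def)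
  define A where "A = 4 ^ r * N * C + 4 ^ r * N * (64 * C / fejer_mass) + 2 * C / fejer_mass * B
      + 2 * C + 8 * C / fejer_mass"
  have lim: "((\<lambda>x::real. ln x / x) \<longlongrightarrow> 0) at_top" by (rule ln_x_over_x_tendsto_0)
  have ev1: "eventually (\<lambda>Y. ln Y / Y < min c1 (D / 4 / (1 + \<theta>))) at_top"
    by (rule order_tendstoD[OF lim]) (use c1 D \<theta> in auto)
  have ev2: "eventually (\<lambda>Y::real. max 1 c1 \<le> ln Y) at_top"
    using ln_at_top unfolding filterlim_at_top by (rule spec)
  have "eventually (\<lambda>Y. norm (a Y) \<le> A * c1 powr - \<theta> * norm ((ln Y / Y) powr \<theta>)) at_top"
    using ev1 ev2 eventually_ge_at_top[of 4] eventually_ge_at_top[of "32 * max_step"]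
      eventually_ge_at_top[of "8 / 3 * (2 * real r * max_step) + 8 / 3"]
  proof eventually_elim
    case (elim Y)
    have Y: "4 \<le> Y" and L: "1 \<le> ln Y" "c1 \<le> ln Y" using elim by auto
    define x where "x = c1 * Y / ln Y"
    have x: "1 \<le> x" "x \<le> Y"
    proof -
      have "ln Y / Y < c1" using elim by simp
      then show "1 \<le> x" using Y L by (simp add: x_def field_simps)
      show "x \<le> Y" using Y L mult_right_mono[OF L(2), of Y] by (simp add: x_def field_simps)
    qed
    define T where "T = x powr (2 * \<theta>)"
    define \<eta> where "\<eta> = x powr - \<theta>"
    have T: "1 \<le> T" using x \<theta> by (simp add: T_def ge_one_powr_ge_zero)
    have \<eta>: "0 < \<eta>" "\<eta> \<le> 1" using x \<theta> powr_mono[of "- \<theta>" 0 x] by (auto simp: \<eta>_def)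
    have T\<eta>: "1 / (T * \<eta>) = \<eta>" "T = \<eta> * x powr (3 * \<theta>)"
      using x by (simp_all add: T_def \<eta>_def powr_minus field_simps flip: powr_add)
    have "1 / T = \<eta> * \<eta>" using T\<eta>(1) \<eta> T by (simp add: field_simps)
    then have T1: "1 / T \<le> \<eta>" using \<eta> by (simp add: mult_left_le)
    have Y\<theta>: "Y powr - \<theta> \<le> \<eta>" unfolding \<eta>_def using x \<theta> by (intro powr_mono2') auto
    have T2: "T * Y powr (1 - real r) \<le> \<eta>"
    proof -
      have "x powr (3 * \<theta>) \<le> Y powr (3 * \<theta>)" using x \<theta> by (intro powr_mono2) auto
      also have "\<dots> \<le> Y powr (real r - 1)" using r Y by (intro powr_mono) auto
      finally have "x powr (3 * \<theta>) * Y powr (1 - real r) \<le> Y powr (real r - 1) * Y powr (1 - real r)"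
        by (intro mult_right_mono) auto
      also have "\<dots> = 1" using Y by (simp flip: powr_add)
      finally show ?thesis using \<eta> by (subst T\<eta>(2)) (simp add: mult.assoc mult_left_le)
    qed
    define n where "n = nat \<lfloor>Y / (16 * max_step)\<rfloor>"
    have "2 \<le> Y / (16 * max_step)" using elim W by (simp add: field_simps)
    then have n: "Y / (16 * max_step) - 1 \<le> real n" "real n \<le> Y / (16 * max_step)" "1 \<le> n"
      "Y / (32 * max_step) \<le> real n"
      unfolding n_def by linarith+
    have nW: "2 * real n * max_step \<le> Y / 8" using n(2) W by (simp add: field_simps)
    have n1: "1 + 2 * real n \<le> N * Y"
    proof -
      have "2 * real n \<le> 1 / (8 * max_step) * Y" using nW W by (simp add: field_simps)
      then show ?thesis using Y unfolding N_def distrib_right by linarith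
    qed
    have \<delta>: "norm ((1 - charf_residual t) ^ (2 * r) * lazy t ^ (2 * n)) \<le> B * Y powr - real r"
      if t: "t \<in> {0..T}" for t
    proof -
      have n0: "0 < real n" using n(3) by simp
      have "2 * real r / (real n * c) \<le> 64 * max_step * real r / c / Y"
      proof -
        have "Y \<le> real n * (32 * max_step)" using n(4) W by (simp add: field_simps)
        from mult_left_mono[OF this, of "2 * real r"] show ?thesis
          using n0 c Y by (simp add: field_simps)
      qed
      then have "(2 * real r / (real n * c)) ^ r \<le> (64 * max_step * real r / c / Y) ^ r"
        using n0 c by (intro power_mono) auto
      also have "\<dots> = (64 * max_step * real r / c) ^ r * Y powr - real r"
        using Y unfolding power_divide[of _ Y] by (simp add: powr_minus powr_realpow divide_inverse)
      finally have 1: "(2 * real r / (real n * c)) ^ r \<le> (64 * max_step * real r / c) ^ r * Y powr - real r" .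
      have "T powr - \<kappa> = x powr (- (2 * \<theta> * \<kappa>))" by (simp add: T_def powr_powr)
      also have "\<dots> = ln Y / (c1 * Y)" using x \<theta> by (simp add: powr_minus_divide) (simp add: x_def)
      finally have Tk: "T powr - \<kappa> = ln Y / (c1 * Y)" .
      have "real r * ln Y = Y / (32 * max_step) * (c * (ln Y / (c1 * Y)) / 2)"
        using Y W c r by (simp add: c1_def field_simps)
      also have "\<dots> \<le> real n * (c * (ln Y / (c1 * Y)) / 2)"
        using n(4) c c1 Y L by (intro mult_right_mono) auto
      finally have "- real n * c * T powr - \<kappa> / 2 \<le> - real r * ln Y" unfolding Tk by simp
      then have 2: "exp (- real n * c * T powr - \<kappa> / 2) \<le> Y powr - real r"
        using Y by (simp add: powr_def)
      have "norm ((1 - charf_residual t) ^ (2 * r) * lazy t ^ (2 * n))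
        \<le> max_step ^ (2 * r) * (2 * real r / (real n * c)) ^ r
         + 4 ^ r * exp (- real n * c * T powr - \<kappa> / 2)"
        using t by (intro norm_multiplier_power_le c \<kappa> dioph n(3) r(2)) auto
      also have "\<dots> \<le> max_step ^ (2 * r) * ((64 * max_step * real r / c) ^ r * Y powr - real r)
          + 4 ^ r * Y powr - real r"
        using W by (intro add_mono mult_left_mono 1 2) auto
      also have "\<dots> = B * Y powr - real r" by (simp add: B_def algebra_simps)
      finally show ?thesis .
    qed
    have "real (2 * r + 2 * n) * max_step = 2 * real r * max_step + 2 * real n * max_step"
      by (simp add: algebra_simps)
    also have "\<dots> \<le> Y / 2 - 1" using nW elim(5) by linarith
    finally have steps: "real (2 * r + 2 * n) * max_step \<le> Y / 2 - 1" .
    have "\<bar>a Y\<bar> \<le> 4 ^ r * (1 + 2 * real n) * (C * exp (- D * (Y / 4)) + 64 * C / fejer_mass / (T * Y))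
      + 2 * C * Y * T / fejer_mass * (B * Y powr - real r) + 2 * C * \<eta> + 8 * C / fejer_mass / (T * \<eta>)"
      using T by (intro abs_le_of_small_defects[OF a a_neg C slow D renewal residual Y _ \<eta> steps \<delta>]) auto
    also have "4 ^ r * (1 + 2 * real n) * (C * exp (- D * (Y / 4)) + 64 * C / fejer_mass / (T * Y))
      \<le> 4 ^ r * (N * Y) * (C * exp (- D * (Y / 4)) + 64 * C / fejer_mass / (T * Y))"
      using n1 C0 fm T Y by (intro mult_right_mono mult_left_mono) auto
    also have "\<dots> = 4 ^ r * N * C * (Y * exp (- D * (Y / 4))) + 4 ^ r * N * (64 * C / fejer_mass) * (1 / T)"
      using Y T fm by (simp add: field_simps)
    also have "\<dots> \<le> 4 ^ r * N * C * \<eta> + 4 ^ r * N * (64 * C / fejer_mass) * \<eta>"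
    proof (intro add_mono mult_left_mono T1)
      have "ln Y / Y < D / 4 / (1 + \<theta>)" using elim by simp
      then have "(1 + \<theta>) * ln Y \<le> D * (Y / 4)" using Y \<theta> by (simp add: field_simps)
      then have "exp (ln Y) * exp (- D * (Y / 4)) \<le> exp (- \<theta> * ln Y)"
        unfolding exp_add[symmetric] by (simp add: algebra_simps)
      then have "Y * exp (- D * (Y / 4)) \<le> Y powr - \<theta>" using Y by (simp add: powr_def)
      then show "Y * exp (- D * (Y / 4)) \<le> \<eta>" using Y\<theta> by linarith
    qed (use N C0 fm in auto)
    also have "2 * C * Y * T / fejer_mass * (B * Y powr - real r)
        = 2 * C / fejer_mass * B * (T * Y powr (1 - real r))"
      using Y by (simp add: powr_diff powr_minus divide_inverse)
    also have "\<dots> \<le> 2 * C / fejer_mass * B * \<eta>"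
      using T2 C0 fm B by (intro mult_left_mono) auto
    also have "8 * C / fejer_mass / (T * \<eta>) = 8 * C / fejer_mass * \<eta>"
      using T\<eta>(1) by (metis divide_inverse mult_1 inverse_eq_divide)
    finally have "\<bar>a Y\<bar> \<le> A * \<eta>" by (simp add: A_def distrib_right)
    also have "\<eta> = c1 powr - \<theta> * (ln Y / Y) powr \<theta>"
      unfolding \<eta>_def x_def using c1 Y L by (simp add: powr_mult powr_divide powr_minus field_simps)
    finally show ?case by simp
  qed
  then show ?thesis unfolding \<theta>_def by (rule bigoI)
qed

end

section \<open>Simultaneous approximation and the characteristic function\<close>

lemma one_minus_cos_ge:
  assumes "\<bar>x\<bar> \<le> pi"
  shows "x\<^sup>2 / 8 \<le> 1 - cos x"
proof -
  define y where "y = \<bar>x / 2\<bar>"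
  have "y \<le> 8 / 5" using assms pi_approx(2) by (simp add: y_def)
  then have y: "0 \<le> y" "y\<^sup>2 \<le> 3"
    using power_mono[of y "8 / 5" 2] by (auto simp: y_def power2_eq_square)
  have "\<bar>sin y - y\<bar> \<le> y ^ 3 / 6"
    using Maclaurin_sin_bound[of y 3] y by (simp add: sin_coeff_def eval_nat_numeral)
  also have "y ^ 3 / 6 \<le> y / 2"
    using mult_left_mono[OF y(2) y(1)] by (simp add: eval_nat_numeral)
  finally have "y / 2 \<le> sin y" by linarith
  then have "(y / 2)\<^sup>2 \<le> (sin y)\<^sup>2" using y by (intro power_mono) auto
  moreover have "cos x = cos (2 * y)" by (simp add: y_def abs_if)
  ultimately show ?thesis using cos_double_sin[of y] by (simp add: y_def power_divide)
qed

lemma one_minus_cos_ge_round: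
  fixes z :: real
  shows "(z - of_int (round z))\<^sup>2 \<le> 1 - cos (2 * pi * z)"
proof -
  let ?d = "z - of_int (round z)"
  have d: "\<bar>?d\<bar> \<le> 1 / 2" using of_int_round_abs_le[of z] by (simp add: abs_minus_commute)
  have "cos (2 * pi * z) = cos (2 * pi * ?d + 2 * pi * of_int (round z))" by (simp add: algebra_simps)
  also have "\<dots> = cos (2 * pi * ?d)"
    by (simp add: cos_add sin_integer_2pi cos_integer_2pi)
  finally have "cos (2 * pi * z) = cos (2 * pi * ?d)" .
  moreover have "(2 * pi * ?d)\<^sup>2 / 8 \<le> 1 - cos (2 * pi * ?d)"
    using d by (intro one_minus_cos_ge) (simp add: abs_mult)
  moreover have "?d\<^sup>2 \<le> (2 * pi * ?d)\<^sup>2 / 8"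
  proof -
    have "8 \<le> (2 * pi)\<^sup>2" using power_mono[of 6 "2 * pi" 2] pi_gt3 by simp
    from mult_right_mono[OF this, of "?d\<^sup>2"] show ?thesis by (simp add: power_mult_distrib)
  qed
  ultimately show ?thesis by linarith
qed

text \<open>Let \<open>m j\<close> be the integer nearest to \<open>z j = t w\<^sub>j / 2\<pi>\<close> and \<open>d j\<close> the difference. Then
  \<open>m\<^sub>1 w\<^sub>j - m\<^sub>j w\<^sub>1 = d\<^sub>j w\<^sub>1 - d\<^sub>1 w\<^sub>j\<close>, so the hypothesis with denominator \<open>q = m\<^sub>1\<close> (of order \<open>t\<close>) bounds some
  \<open>\<bar>d i\<bar>\<close> from below. If \<open>m\<^sub>1 = 0\<close>, then \<open>t w\<^sub>1 \<le> \<pi>\<close> and the first cosine gives the quadratic bound.\<close>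

lemma cosine_sum_lower_bound:
  fixes w p :: "nat \<Rightarrow> real"
  assumes flow: "self_similar_flow N w" and p: "\<And>j. j \<in> {1..N} \<Longrightarrow> 0 < p j"
    and C: "0 < C" and \<tau>: "0 < \<tau>"
    and approx: "\<And>(q::int) m. 1 \<le> q \<Longrightarrow>
      \<exists>j\<in>{1..N}. C * of_int q powr - \<tau> \<le> \<bar>of_int q * w j - of_int (m j) * w 1\<bar>"
  shows "\<exists>c>0. \<forall>t>0. c * min (t\<^sup>2) (t powr - (2 * \<tau>)) \<le> (\<Sum>j=1..N. p j * (1 - cos (t * w j)))"
proof -
  have N: "N \<ge> 2" and w1: "0 < w 1" using flow by (auto simp: self_similar_flow_def)
  have wpos: "0 < w j" and wN: "w j \<le> w N" if "j \<in> {1..N}" for j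
    using self_similar_flow_pos[OF flow that] flow that
    unfolding self_similar_flow_def by (auto intro!: mono_onD[of "{1..N}" w])
  have w0: "0 < w N" using wpos[of N] N by simp
  define P where "P = Min (p ` {1..N})"
  have P: "0 < P" unfolding P_def using p N by (subst Min_gr_iff) auto
  have term_le: "P * (1 - cos (t * w j)) \<le> (\<Sum>j=1..N. p j * (1 - cos (t * w j)))" if j: "j \<in> {1..N}" for j t
  proof -
    have "P \<le> p j" unfolding P_def using j by (intro Min_le) auto
    then have "P * (1 - cos (t * w j)) \<le> p j * (1 - cos (t * w j))" by (intro mult_right_mono) auto
    also have "\<dots> \<le> (\<Sum>j=1..N. p j * (1 - cos (t * w j)))"
      using p by (intro member_le_sum[OF j]) (auto intro!: mult_nonneg_nonneg[OF less_imp_le[OF p]])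
    finally show ?thesis .
  qed
  define c1 where "c1 = P * (w 1)\<^sup>2 / 8"
  define c2 where "c2 = P * (C / (2 * w N))\<^sup>2 * (w 1 / pi) powr - (2 * \<tau>)"
  have c: "0 < c1" "0 < c2" using P w1 C w0 by (auto simp: c1_def c2_def)
  have "min c1 c2 * min (t\<^sup>2) (t powr - (2 * \<tau>)) \<le> (\<Sum>j=1..N. p j * (1 - cos (t * w j)))"
    if t: "0 < t" for t
  proof -
    let ?S = "\<Sum>j=1..N. p j * (1 - cos (t * w j))"
    define z where "z j = t * w j / (2 * pi)" for j
    define m where "m j = round (z j)" for j
    define d where "d j = z j - of_int (m j)" for j
    have z1: "0 < z 1" using t w1 by (simp add: z_def)
    then have m1: "0 \<le> m 1" unfolding m_def round_def by simp
    have dS: "P * (d j)\<^sup>2 \<le> ?S" if "j \<in> {1..N}" for j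
    proof -
      have "(d j)\<^sup>2 \<le> 1 - cos (t * w j)"
        using one_minus_cos_ge_round[of "z j"] by (simp add: d_def m_def z_def)
      then show ?thesis using term_le[OF that, of t] P by (meson mult_left_mono order_trans less_imp_le)
    qed
    show ?thesis
    proof (cases "m 1 = 0")
      case True
      then have "\<bar>z 1\<bar> \<le> 1 / 2" using of_int_round_abs_le[of "z 1"] by (simp add: m_def)
      then have "\<bar>t * w 1\<bar> \<le> pi" by (simp add: z_def field_simps)
      then have "(t * w 1)\<^sup>2 / 8 \<le> 1 - cos (t * w 1)" by (rule one_minus_cos_ge)
      then have "P * ((t * w 1)\<^sup>2 / 8) \<le> P * (1 - cos (t * w 1))" using P by (intro mult_left_mono) auto
      also have "\<dots> \<le> ?S" using N by (intro term_le) auto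
      finally have "c1 * t\<^sup>2 \<le> ?S" by (simp add: c1_def power_mult_distrib algebra_simps)
      moreover have "min c1 c2 * min (t\<^sup>2) (t powr - (2 * \<tau>)) \<le> c1 * t\<^sup>2"
        using c by (intro mult_mono) auto
      ultimately show ?thesis by linarith
    next
      case False
      then have q: "1 \<le> m 1" using m1 by simp
      then obtain j where j: "j \<in> {1..N}"
        and ge: "C * of_int (m 1) powr - \<tau> \<le> \<bar>of_int (m 1) * w j - of_int (m j) * w 1\<bar>"
        using approx[of "m 1" m] by blast
      have "z 1 * w j = z j * w 1" by (simp add: z_def)
      then have "of_int (m 1) * w j - of_int (m j) * w 1 = d j * w 1 - d 1 * w j"
        by (simp add: d_def algebra_simps)
      also have "\<bar>\<dots>\<bar> \<le> \<bar>d j\<bar> * w 1 + \<bar>d 1\<bar> * w j"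
        using abs_triangle_ineq4[of "d j * w 1" "d 1 * w j"] wpos[OF j] w1 by (simp add: abs_mult)
      also have "\<dots> \<le> \<bar>d j\<bar> * w N + \<bar>d 1\<bar> * w N"
        using wN[OF j] wN[of 1] N by (intro add_mono mult_left_mono) auto
      finally have sum: "C * of_int (m 1) powr - \<tau> \<le> (\<bar>d j\<bar> + \<bar>d 1\<bar>) * w N"
        using ge by (simp add: distrib_right)
      define e where "e = C / (2 * w N) * of_int (m 1) powr - \<tau>"
      have "2 * e \<le> \<bar>d j\<bar> + \<bar>d 1\<bar>" using sum w0 by (simp add: e_def field_simps)
      then have "e \<le> \<bar>d j\<bar> \<or> e \<le> \<bar>d 1\<bar>" by linarith
      then have "\<exists>i\<in>{1..N}. e \<le> \<bar>d i\<bar>"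
      proof
        show ?thesis if "e \<le> \<bar>d j\<bar>" using that j by (rule bexI)
        show ?thesis if "e \<le> \<bar>d 1\<bar>" using that N by (intro bexI[of _ 1]) auto
      qed
      then obtain i where i: "i \<in> {1..N}" "e \<le> \<bar>d i\<bar>" by blast
      have e0: "0 \<le> e" using C w0 by (simp add: e_def)
      have "of_int (m 1) \<le> t * w 1 / pi"
      proof -
        have "of_int (m 1) \<le> z 1 + 1 / 2" unfolding m_def by (rule of_int_round_le)
        moreover have "(1::real) \<le> of_int (m 1)" using q by simp
        ultimately have "of_int (m 1) \<le> 2 * z 1" by linarith
        then show ?thesis by (simp add: z_def)
      qed
      then have "(t * w 1 / pi) powr - (2 * \<tau>) \<le> of_int (m 1) powr - (2 * \<tau>)"
        using q \<tau> by (intro powr_mono2') auto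
      then have "P * (C / (2 * w N))\<^sup>2 * (t * w 1 / pi) powr - (2 * \<tau>)
          \<le> P * (C / (2 * w N))\<^sup>2 * of_int (m 1) powr - (2 * \<tau>)"
        using P by (intro mult_left_mono) auto
      also have "of_int (m 1) powr - (2 * \<tau>) = (of_int (m 1) powr - \<tau> :: real)\<^sup>2"
        using q by (simp add: power2_eq_square flip: powr_add)
      also have "P * (C / (2 * w N))\<^sup>2 * (of_int (m 1) powr - \<tau>)\<^sup>2 = P * e\<^sup>2"
        by (simp add: e_def power_mult_distrib power_divide)
      also have "\<dots> \<le> P * (d i)\<^sup>2"
        using power_mono[OF i(2) e0, of 2] P by (intro mult_left_mono) auto
      also have "\<dots> \<le> ?S" by (rule dS[OF i(1)])
      finally have "P * (C / (2 * w N))\<^sup>2 * (t * w 1 / pi) powr - (2 * \<tau>) \<le> ?S" .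
      moreover have "(t * w 1 / pi) powr - (2 * \<tau>) = t powr - (2 * \<tau>) * (w 1 / pi) powr - (2 * \<tau>)"
        using t w1 by (simp flip: powr_mult)
      ultimately have "c2 * t powr - (2 * \<tau>) \<le> ?S" by (simp add: c2_def ac_simps)
      moreover have "min c1 c2 * min (t\<^sup>2) (t powr - (2 * \<tau>)) \<le> c2 * t powr - (2 * \<tau>)"
        using c by (intro mult_mono) auto
      ultimately show ?thesis by linarith
    qed
  qed
  then show ?thesis using c by (intro exI[of _ "min c1 c2"]) auto
qed

text \<open>The exponent cannot be negative, since an increasing positive function does not tend to 0. Monotonicity
  also extends the asymptotic bound on the function to all \<open>q \<ge> 1\<close>, with a larger constant.\<close>

lemma polynomially_approximable_bound:
  assumes flow: "self_similar_flow N w" and poly: "polynomially_approximable N w l"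
  shows "0 \<le> l" and "\<exists>C>0. \<forall>q::int. \<forall>m. 1 \<le> q \<longrightarrow>
    (\<exists>j\<in>{1..N}. C * of_int q powr - (l + 1 / (real N - 1)) \<le> \<bar>of_int q * w j - of_int (m j) * w 1\<bar>)"
proof -
  have N: "N \<ge> 2" and w1: "0 < w 1" using flow by (auto simp: self_similar_flow_def)
  obtain a :: "real \<Rightarrow> real" where a: "\<And>x. 1 \<le> x \<Longrightarrow> 0 < a x" "mono_on {1..} a" "a \<in> O(\<lambda>x. x powr l)"
    and approx: "\<And>(q::int) m. 1 \<le> q \<Longrightarrow> \<exists>j\<in>{1..N}. w 1 / a (of_int q) * of_int q powr (- 1 / (real N - 1))
        \<le> \<bar>of_int q * w j - of_int (m j) * w 1\<bar>"
    using poly unfolding polynomially_approximable_def by blast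
  obtain K where K: "eventually (\<lambda>x. norm (a x) \<le> K * norm (x powr l)) at_top"
    using landau_o.bigE[OF a(3)] by blast
  show l: "0 \<le> l"
  proof (rule ccontr)
    assume "\<not> 0 \<le> l"
    then have "((\<lambda>x::real. K * x powr l) \<longlongrightarrow> K * 0) at_top"
      by (intro tendsto_mult tendsto_const tendsto_neg_powr filterlim_ident) auto
    then have "eventually (\<lambda>x. K * x powr l < a 1) at_top"
      by (rule order_tendstoD) (use a(1)[of 1] in simp)
    then have "eventually (\<lambda>x::real. False) at_top"
      using K eventually_ge_at_top[of 1]
    proof eventually_elim
      case (elim x)
      have "a 1 \<le> a x" using a(2) elim(3) by (auto intro: mono_onD)
      then show False using elim by simp
    qed
    then show False by simp
  qed
  obtain X where X: "\<And>x. X \<le> x \<Longrightarrow> norm (a x) \<le> K * norm (x powr l)"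
    using K unfolding eventually_at_top_linorder by blast
  define M where "M = max K (a (max 1 X))"
  have M: "0 < M" using a(1)[of "max 1 X"] by (simp add: M_def)
  have aM: "a x \<le> M * x powr l" if x: "1 \<le> x" for x
  proof (cases "X \<le> x")
    case True
    have "a x \<le> K * x powr l" using X[OF True] by simp
    also have "\<dots> \<le> M * x powr l" by (intro mult_right_mono) (auto simp: M_def)
    finally show ?thesis .
  next
    case False
    then have "a x \<le> a (max 1 X)" using a(2) x by (auto intro: mono_onD)
    also have "\<dots> \<le> M * 1" by (simp add: M_def)
    also have "\<dots> \<le> M * x powr l" using M x l by (intro mult_left_mono) (auto simp: ge_one_powr_ge_zero)
    finally show ?thesis .
  qed
  have "\<exists>j\<in>{1..N}. w 1 / M * of_int q powr - (l + 1 / (real N - 1)) \<le> \<bar>of_int q * w j - of_int (m j) * w 1\<bar>"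
    if q: "1 \<le> q" for q :: int and m
  proof -
    have q1: "1 \<le> (of_int q :: real)" using q by simp
    have "w 1 / M * of_int q powr - (l + 1 / (real N - 1))
        = w 1 / (M * of_int q powr l) * of_int q powr (- 1 / (real N - 1))"
      using q1 by (simp add: powr_diff powr_minus powr_add divide_inverse)
    also have "\<dots> \<le> w 1 / a (of_int q) * of_int q powr (- 1 / (real N - 1))"
      using aM[OF q1] a(1)[OF q1] w1 by (intro mult_right_mono divide_left_mono) auto
    finally have le: "w 1 / M * of_int q powr - (l + 1 / (real N - 1))
        \<le> w 1 / a (of_int q) * of_int q powr (- 1 / (real N - 1))" .
    obtain j where "j \<in> {1..N}" "w 1 / a (of_int q) * of_int q powr (- 1 / (real N - 1))
        \<le> \<bar>of_int q * w j - of_int (m j) * w 1\<bar>" using approx[OF q] by blast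
    then show ?thesis using le by (intro bexI[of _ j]) linarith
  qed
  then show "\<exists>C>0. \<forall>q::int. \<forall>m. 1 \<le> q \<longrightarrow>
    (\<exists>j\<in>{1..N}. C * of_int q powr - (l + 1 / (real N - 1)) \<le> \<bar>of_int q * w j - of_int (m j) * w 1\<bar>)"
    using M w1 by (intro exI[of _ "w 1 / M"]) auto
qed

lemma badly_approximable_imp_polynomially:
  assumes flow: "self_similar_flow N w" and bad: "badly_approximable N w"
  shows "polynomially_approximable N w 0"
proof -
  have w1: "0 < w 1" using flow by (auto simp: self_similar_flow_def)
  obtain c where c: "0 < c" and "\<forall>q::int. \<forall>p. q \<ge> 1 \<longrightarrow>
      (\<exists>j\<in>{1..N}. \<bar>of_int q * w j - of_int (p j) * w 1\<bar> \<ge> c * of_int q powr (- 1 / (real N - 1)))"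
    using bad unfolding badly_approximable_def by blast
  moreover have "(\<lambda>_. w 1 / c) \<in> O(\<lambda>x::real. x powr 0)"
    by (rule bigoI[of _ "\<bar>w 1 / c\<bar>"]) (use eventually_gt_at_top[of 0] in eventually_elim, auto)
  ultimately show ?thesis
    unfolding polynomially_approximable_def using w1
    by (intro exI[of _ "\<lambda>_. w 1 / c"]) (auto simp: mono_on_def)
qed

section \<open>The prime orbit theorem\<close>

lemma bigo_shifted_log_ratio:
  fixes f :: "real \<Rightarrow> real"
  assumes f: "f \<in> O(\<lambda>y. (ln y / y) powr \<theta>)" and \<theta>: "0 < \<theta>"
  shows "(\<lambda>x. f (ln x - c)) \<in> O(\<lambda>x. (ln (ln x) / ln x) powr \<theta>)"
proof -
  have lim: "filterlim (\<lambda>x::real. - c + ln x) at_top at_top"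
    by (rule filterlim_tendsto_add_at_top[OF tendsto_const ln_at_top])
  have "(\<lambda>x. f (- c + ln x)) \<in> O(\<lambda>x. (ln (- c + ln x) / (- c + ln x)) powr \<theta>)"
    by (rule landau_o.big.compose[OF f lim])
  also have "(\<lambda>x. (ln (- c + ln x) / (- c + ln x)) powr \<theta>) \<in> O(\<lambda>x. (ln (ln x) / ln x) powr \<theta>)"
  proof (rule bigoI)
    have "eventually (\<lambda>x::real. max 2 (max (2 * \<bar>c\<bar>) (\<bar>c\<bar> + 1)) \<le> ln x) at_top"
      using ln_at_top unfolding filterlim_at_top by (rule spec)
    then show "eventually (\<lambda>x. norm ((ln (- c + ln x) / (- c + ln x)) powr \<theta>)
        \<le> 4 powr \<theta> * norm ((ln (ln x) / ln x) powr \<theta>)) at_top"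
    proof eventually_elim
      case (elim x)
      define y where "y = ln x"
      have y: "2 \<le> y" "2 * \<bar>c\<bar> \<le> y" "\<bar>c\<bar> + 1 \<le> y" using elim by (auto simp: y_def)
      have "2 * y \<le> y * y" using y by (intro mult_right_mono) auto
      then have z: "1 \<le> - c + y" "y / 2 \<le> - c + y" "- c + y \<le> y * y"
        using y by linarith+
      have "ln (- c + y) \<le> ln (y * y)" using z y by (subst ln_le_cancel_iff) auto
      then have "ln (- c + y) / (- c + y) \<le> 2 * ln y / (y / 2)"
        using z y by (intro frac_le) (auto simp: ln_mult)
      then have "(ln (- c + y) / (- c + y)) powr \<theta> \<le> (4 * (ln y / y)) powr \<theta>"
        using z \<theta> by (intro powr_mono2) auto
      also have "\<dots> = 4 powr \<theta> * (ln y / y) powr \<theta>" by (rule powr_mult)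
      finally show ?case by (simp add: y_def)
    qed
  qed
  finally show ?thesis by simp
qed

context
  fixes N :: nat and w :: "nat \<Rightarrow> real" and D :: real
  assumes flow: "self_similar_flow N w"
    and D: "(\<Sum>j=1..N. exp (- w j * D)) = 1"
begin

interpretation step_distribution "{1..N}" "\<lambda>j. exp (- w j * D)" w
  using self_similar_flow_pos[OF flow] D by unfold_locales auto

text \<open>The function \<open>A\<close> of the introduction; the weights \<open>exp (- w j * D)\<close> are the step probabilities.\<close>

definition tilted_count :: "real \<Rightarrow> real" where
  "tilted_count y = exp (- D * y) * real (word_count N w y)"

lemma D_pos: "0 < D" by (rule flow_dimension_ex1(2)[OF flow D])

lemma N_ge: "2 \<le> N" using flow by (simp add: self_similar_flow_def)

lemma w_le_last: "j \<in> {1..N} \<Longrightarrow> w j \<le> w N"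
  using flow unfolding self_similar_flow_def by (auto intro!: mono_onD[of "{1..N}" w])

lemma w_last_pos: "0 < w N" using self_similar_flow_pos[OF flow, of N] N_ge by simp

lemma tilted_count_neg: "y < 0 \<Longrightarrow> tilted_count y = 0"
  by (simp add: tilted_count_def word_count_neg[OF flow])

lemma tilted_count_nonneg: "0 \<le> tilted_count y"
  by (simp add: tilted_count_def)

lemma tilted_count_le: "tilted_count y \<le> exp (D * w N)"
proof (cases "0 \<le> y")
  case True
  then have "real (word_count N w y) \<le> exp (D * (y + w N))"
    using word_count_bound[OF flow D, of y] w_last_pos by simp
  then have "exp (- D * y) * real (word_count N w y) \<le> exp (- D * y) * exp (D * (y + w N))"
    by (intro mult_left_mono) auto
  also have "\<dots> = exp (D * w N)" by (simp add: exp_add[symmetric] algebra_simps)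
  finally show ?thesis by (simp add: tilted_count_def)
qed (simp add: tilted_count_neg)

lemma tilted_count_rec:
  assumes "0 \<le> y"
  shows "tilted_count y = exp (- D * y) + (\<Sum>j=1..N. exp (- w j * D) * tilted_count (y - w j))"
proof -
  have "exp (- D * y) * real (word_count N w (y - w j)) = exp (- w j * D) * tilted_count (y - w j)" for j
    by (simp add: tilted_count_def mult.assoc[symmetric] exp_add[symmetric] algebra_simps)
  then show ?thesis
    unfolding tilted_count_def[of y] word_count_rec[OF flow assms]
    by (simp add: distrib_left sum_distrib_left)
qed

lemma borel_measurable_tilted_count [measurable]: "tilted_count \<in> borel_measurable borel"
proof -
  have "mono (\<lambda>y. real (word_count N w y))"
    using word_count_mono[OF flow] by (intro monoI) auto
  then have [measurable]: "(\<lambda>y. real (word_count N w y)) \<in> borel_measurable borel"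
    by (rule borel_measurable_mono)
  show ?thesis unfolding tilted_count_def[abs_def] by measurable
qed

text \<open>The product \<open>e\<^bsup>Dy\<^esup> A(y)\<close> is increasing and \<open>A\<close> is bounded, so \<open>A\<close> falls at most at a linear rate.\<close>

lemma tilted_count_slow:
  assumes "v \<le> v'"
  shows "tilted_count v - D * exp (D * w N) * (v' - v) \<le> tilted_count v'"
proof -
  have "tilted_count v - D * (v' - v) * exp (D * w N) \<le> tilted_count v - D * (v' - v) * tilted_count v"
    using tilted_count_le[of v] D_pos assms by (intro diff_left_mono mult_left_mono) auto
  also have "\<dots> = (1 + - D * (v' - v)) * tilted_count v" by (simp add: algebra_simps)
  also have "\<dots> \<le> exp (- D * (v' - v)) * tilted_count v"
    by (intro mult_right_mono exp_ge_add_one_self tilted_count_nonneg)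
  also have "\<dots> = exp (- D * v') * real (word_count N w v)"
    unfolding tilted_count_def mult.assoc[symmetric] exp_add[symmetric] by (simp add: algebra_simps)
  also have "\<dots> \<le> tilted_count v'"
    unfolding tilted_count_def using word_count_mono[OF flow assms] by (intro mult_left_mono) auto
  finally show ?thesis by (simp add: ac_simps)
qed

lemma integrable_tilted_count: "integrable lborel (\<lambda>x. indicator {a..b} x * tilted_count (x - c))"
proof (rule Bochner_Integration.integrable_bound)
  show "integrable lborel (\<lambda>x. indicator {a..b} x * exp (D * w N))"
    by (intro integrable_mult_left integrable_indicator_Icc)
  show "AE x in lborel. norm (indicator {a..b} x * tilted_count (x - c)) \<le> norm (indicator {a..b} x * exp (D * w N))"
    using tilted_count_le tilted_count_nonneg by (intro always_eventually allI) (auto simp: abs_mult mult_left_mono)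
qed measurable

text \<open>The integral of \<open>A\<close> over \<open>[v - w\<^sub>j, v]\<close> is that of \<open>A(x) - A(x - w\<^sub>j)\<close> over \<open>[0, v]\<close>. Averaging over \<open>j\<close>
  produces the integral of \<open>A - PA\<close>, which is \<open>e\<^bsup>-Dx\<^esup>\<close> by the renewal equation. This exact
  evaluation is what identifies the limit of \<open>A\<close>.\<close>

lemma tilted_count_residual_average:
  assumes v: "w N \<le> v"
  shows "(\<Sum>j=1..N. exp (- w j * D) * (\<integral>s. indicator {0..w j} s * tilted_count (v - s) \<partial>lborel))
       = (1 - exp (- D * v)) / D"
proof -
  let ?A = tilted_count
  have v0: "0 < v" using v w_last_pos by linarith
  have win: "(\<integral>s. indicator {0..w j} s * ?A (v - s) \<partial>lborel)
      = (\<integral>x. indicator {0..v} x * ?A (x - 0) \<partial>lborel) - (\<integral>x. indicator {0..v} x * ?A (x - w j) \<partial>lborel)"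
    if j: "j \<in> {1..N}" for j
  proof -
    have wj: "0 < w j" "w j \<le> v" using self_similar_flow_pos[OF flow j] w_le_last[OF j] v by auto
    have i: "integrable lborel (\<lambda>x. indicator {0..<v - w j} x * ?A x)"
    proof (rule Bochner_Integration.integrable_bound[OF integrable_tilted_count[of 0 v 0]])
      show "AE x in lborel. norm (indicator {0..<v - w j} x * ?A x) \<le> norm (indicator {0..v} x * ?A (x - 0))"
        using wj by (intro always_eventually allI) (auto simp: indicator_def)
    qed measurable
    have "(\<integral>s. indicator {0..w j} s * ?A (v - s) \<partial>lborel)
        = (\<integral>x. indicator {0..w j} (v + - 1 * x) * ?A (v - (v + - 1 * x)) \<partial>lborel)"
      by (subst lborel_integral_real_affine[of "-1" _ v]) simp_all
    also have "\<dots> = (\<integral>x. indicator {0..v} x * ?A (x - 0) - indicator {0..<v - w j} x * ?A x \<partial>lborel)"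
      using wj by (intro Bochner_Integration.integral_cong refl) (auto simp: indicator_def)
    also have "\<dots> = (\<integral>x. indicator {0..v} x * ?A (x - 0) \<partial>lborel) - (\<integral>x. indicator {0..<v - w j} x * ?A x \<partial>lborel)"
      by (intro Bochner_Integration.integral_diff integrable_tilted_count i)
    also have "(\<integral>x. indicator {0..<v - w j} x * ?A x \<partial>lborel)
        = (\<integral>x. indicator {0..<v - w j} (- w j + 1 * x) * ?A (- w j + 1 * x) \<partial>lborel)"
      by (subst lborel_integral_real_affine[of 1 _ "- w j"]) simp_all
    also have "\<dots> = (\<integral>x. indicator {0..v} x * ?A (x - w j) \<partial>lborel)"
    proof (rule integral_cong_AE)
      show "AE x in lborel. indicator {0..<v - w j} (- w j + 1 * x) * ?A (- w j + 1 * x)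
          = indicator {0..v} x * ?A (x - w j)"
        \<comment> \<open>The two indicators differ at the end point \<open>v\<close> alone.\<close>
        using AE_lborel_singleton[of v]
      proof eventually_elim
        case (elim x)
        then show ?case using wj tilted_count_neg[of "x - w j"]
          by (cases "x < w j") (auto simp: indicator_def)
      qed
    qed measurable
    finally show ?thesis .
  qed
  have "(\<Sum>j=1..N. exp (- w j * D) * (\<integral>s. indicator {0..w j} s * ?A (v - s) \<partial>lborel))
      = (\<Sum>j=1..N. exp (- w j * D) * ((\<integral>x. indicator {0..v} x * ?A (x - 0) \<partial>lborel)
          - (\<integral>x. indicator {0..v} x * ?A (x - w j) \<partial>lborel)))"
    by (intro sum.cong refl arg_cong2[where f = "(*)"] win)
  also have "\<dots> = (\<integral>x. indicator {0..v} x * ?A (x - 0) \<partial>lborel)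
      - (\<Sum>j=1..N. exp (- w j * D) * (\<integral>x. indicator {0..v} x * ?A (x - w j) \<partial>lborel))"
    using D by (simp add: right_diff_distrib sum_subtractf flip: sum_distrib_right)
  also have "\<dots> = (\<integral>x. indicator {0..v} x * ?A (x - 0) \<partial>lborel)
      - (\<integral>x. (\<Sum>j=1..N. exp (- w j * D) * (indicator {0..v} x * ?A (x - w j))) \<partial>lborel)"
    by (subst Bochner_Integration.integral_sum) (intro integrable_mult_right integrable_tilted_count, simp)
  also have "\<dots> = (\<integral>x. indicator {0..v} x * ?A (x - 0)
      - (\<Sum>j=1..N. exp (- w j * D) * (indicator {0..v} x * ?A (x - w j))) \<partial>lborel)"
    by (intro Bochner_Integration.integral_diff[symmetric] Bochner_Integration.integrable_sum
        integrable_mult_right integrable_tilted_count)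
  also have "\<dots> = (\<integral>x. exp (- D * x) * indicator {0..v} x \<partial>lborel)"
  proof (intro Bochner_Integration.integral_cong refl)
    fix x
    show "indicator {0..v} x * ?A (x - 0) - (\<Sum>j=1..N. exp (- w j * D) * (indicator {0..v} x * ?A (x - w j)))
        = exp (- D * x) * indicator {0..v} x"
      using tilted_count_rec[of x] by (cases "x \<in> {0..v}") auto
  qed
  also have "\<dots> = - exp (- D * v) / D - (- exp (- D * 0) / D)"
    using v0 D_pos
    by (intro integral_FTC_Icc_real) (auto intro!: derivative_eq_intros continuous_intros)
  finally show ?thesis by (simp add: diff_divide_distrib)
qed

definition count_error :: "real \<Rightarrow> real" where
  "count_error v = tilted_count v - indicator {0..} v / (D * mean)"

text \<open>Past the longest step, the constant \<open>1/(D mean)\<close> is invariant under \<open>P\<close>, and its residual average cancels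
  the constant term of that of \<open>A\<close>. Both defects of the error are therefore multiples of \<open>e\<^bsup>-Dv\<^esup>\<close>; on the
  bounded interval before that, boundedness is enough.\<close>

lemma count_error_bigo:
  assumes c: "0 < c" and \<kappa>: "0 < \<kappa>"
    and dioph: "\<And>t. 0 < t \<Longrightarrow> c * min (t\<^sup>2) (t powr - \<kappa>) \<le> (\<Sum>j=1..N. exp (- w j * D) * (1 - cos (t * w j)))"
  shows "count_error \<in> O(\<lambda>y. (ln y / y) powr (1 / (2 * \<kappa>)))"
proof -
  define b where "b = exp (D * w N)"
  define L where "L = 1 / (D * mean)"
  have b: "1 \<le> b" using D_pos w_last_pos by (simp add: b_def)
  have L: "0 < L" using D_pos mean_pos by (simp add: L_def)
  define C where "C = (1 + D + b) * (b + L + 1)"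
  have C: "b + L \<le> C" "D * b \<le> C" "1 + L * b \<le> C" "(b + L) * b \<le> C"
    using b L D_pos unfolding C_def by (simp_all add: algebra_simps add_increasing mult_nonneg_nonneg)
  have err: "count_error v = tilted_count v - L * indicator {0..} v" for v
    by (simp add: count_error_def L_def)
  have errC: "\<bar>count_error v\<bar> \<le> b + L" for v
    using tilted_count_le[of v] tilted_count_nonneg[of v] L b
    by (auto simp: err b_def[symmetric] indicator_def abs_le_iff)
  have far: "1 \<le> b * exp (- D * v)" if "v < w N" for v
    using that D_pos by (simp add: b_def exp_add[symmetric])
  show ?thesis
  proof (rule renewal_rate[where C = C and D = D])
    show "count_error \<in> borel_measurable borel" unfolding count_error_def[abs_def] by measurable
    show "count_error v = 0" if "v < 0" for v using that by (simp add: err tilted_count_neg)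
    show "\<bar>count_error v\<bar> \<le> C" for v using errC[of v] C by linarith
    show "count_error v - C * (v' - v) \<le> count_error v'" if "0 \<le> v" "v \<le> v'" for v v'
      using tilted_count_slow[OF that(2)] mult_right_mono[OF C(2), of "v' - v"] that
      by (simp add: err b_def)
    show "\<bar>count_error v - (\<Sum>j=1..N. exp (- w j * D) * count_error (v - w j))\<bar> \<le> C * exp (- D * v)"
      if v: "0 \<le> v" for v
    proof -
      let ?s = "\<Sum>j=1..N. exp (- w j * D) * indicator {0..} (v - w j)"
      define E where "E = exp (- D * v)"
      define Z where "Z = L * (1 - ?s)"
      have "(\<Sum>j=1..N. exp (- w j * D) * count_error (v - w j))
          = (\<Sum>j=1..N. exp (- w j * D) * tilted_count (v - w j)) - L * ?s"
        unfolding err by (simp only: right_diff_distrib sum_subtractf sum_distrib_left mult.left_commute[of L])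
      then have X: "count_error v - (\<Sum>j=1..N. exp (- w j * D) * count_error (v - w j)) = E - Z"
        using tilted_count_rec[OF v] v by (simp add: err Z_def E_def algebra_simps)
      have Z: "0 \<le> Z" "Z \<le> L * (b * E)"
      proof -
        have "0 \<le> 1 - ?s \<and> 1 - ?s \<le> b * E"
        proof (cases "v < w N")
          case True
          have "0 \<le> ?s" by (intro sum_nonneg) auto
          moreover have "?s \<le> (\<Sum>j=1..N. exp (- w j * D))"
            by (intro sum_mono) (auto simp: indicator_def)
          ultimately show ?thesis using far[OF True] D unfolding E_def by linarith
        next
          case False
          have "?s = (\<Sum>j=1..N. exp (- w j * D))"
          proof (rule sum.cong[OF refl])
            fix j assume "j \<in> {1..N}"
            then have "0 \<le> v - w j" using w_le_last[of j] False by simp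
            then show "exp (- w j * D) * indicator {0..} (v - w j) = exp (- w j * D)" by simp
          qed
          then show ?thesis using D b by (simp add: E_def)
        qed
        then show "0 \<le> Z" "Z \<le> L * (b * E)" using L unfolding Z_def by (auto intro: mult_left_mono)
      qed
      have "(1 + L * b) * E \<le> C * E" using C by (intro mult_right_mono) (auto simp: E_def)
      moreover have "(1 + L * b) * E = E + L * (b * E)" by (simp add: algebra_simps)
      moreover have "0 < E" by (simp add: E_def)
      ultimately have "\<bar>E - Z\<bar> \<le> C * E" using Z by linarith
      then show ?thesis unfolding X E_def .
    qed
    show "\<bar>\<Sum>j=1..N. exp (- w j * D) / mean * (\<integral>s. indicator {0..w j} s * count_error (v - s) \<partial>lborel)\<bar>
        \<le> C * exp (- D * v)" if v: "0 \<le> v" for v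
    proof (cases "v < w N")
      case True
      have "\<bar>\<Sum>j=1..N. exp (- w j * D) / mean * (\<integral>s. indicator {0..w j} s * count_error (v - s) \<partial>lborel)\<bar> \<le> b + L"
        by (rule abs_residual_average_le) (rule errC)
      also have "\<dots> \<le> (b + L) * (b * exp (- D * v))"
        using mult_left_mono[OF far[OF True], of "b + L"] b L by simp
      also have "\<dots> \<le> C * exp (- D * v)"
        unfolding mult.assoc[symmetric] using C(4) by (intro mult_right_mono) auto
      finally show ?thesis .
    next
      case False
      have "(\<integral>s. indicator {0..w j} s * count_error (v - s) \<partial>lborel)
          = (\<integral>s. indicator {0..w j} s * tilted_count (v - s) \<partial>lborel) - L * w j" if j: "j \<in> {1..N}" for j
      proof -
        have wj: "0 < w j" "w j \<le> v" using self_similar_flow_pos[OF flow j] w_le_last[OF j] False by auto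
        have i: "integrable lborel (\<lambda>s. indicator {0..w j} s * tilted_count (v - s))"
        proof (rule Bochner_Integration.integrable_bound)
          show "integrable lborel (\<lambda>s. indicator {0..w j} s * b)"
            by (intro integrable_mult_left integrable_indicator_Icc)
          show "AE s in lborel. norm (indicator {0..w j} s * tilted_count (v - s)) \<le> norm (indicator {0..w j} s * b)"
            using tilted_count_le tilted_count_nonneg b unfolding b_def
            by (intro always_eventually allI) (auto simp: abs_mult mult_left_mono)
        qed measurable
        have "(\<integral>s. indicator {0..w j} s * count_error (v - s) \<partial>lborel)
            = (\<integral>s. indicator {0..w j} s * tilted_count (v - s) - indicator {0..w j} s * L \<partial>lborel)"
          using wj by (intro Bochner_Integration.integral_cong refl) (auto simp: err indicator_def)
        also have "\<dots> = (\<integral>s. indicator {0..w j} s * tilted_count (v - s) \<partial>lborel) - L * w j"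
          using wj by (subst Bochner_Integration.integral_diff[OF i])
            (auto intro!: integrable_mult_left integrable_indicator_Icc)
        finally show ?thesis .
      qed
      then have "(\<Sum>j=1..N. exp (- w j * D) / mean * (\<integral>s. indicator {0..w j} s * count_error (v - s) \<partial>lborel))
          = (\<Sum>j=1..N. exp (- w j * D) / mean * ((\<integral>s. indicator {0..w j} s * tilted_count (v - s) \<partial>lborel) - L * w j))"
        by (intro sum.cong refl) simp
      also have "\<dots> = (\<Sum>j=1..N. exp (- w j * D) * (\<integral>s. indicator {0..w j} s * tilted_count (v - s) \<partial>lborel)) / mean
          - L * mean / mean"
        unfolding mean_def by (simp add: sum_divide_distrib right_diff_distrib diff_divide_distrib sum_subtractf sum_distrib_left ac_simps)
      also have "\<dots> = (1 - exp (- D * v)) / D / mean - 1 / D / mean"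
        using False mean_pos by (subst tilted_count_residual_average) (auto simp: L_def)
      also have "\<dots> = - L * exp (- D * v)" by (simp add: L_def field_simps diff_divide_distrib)
      finally have "\<bar>\<Sum>j=1..N. exp (- w j * D) / mean * (\<integral>s. indicator {0..w j} s * count_error (v - s) \<partial>lborel)\<bar>
          = L * exp (- D * v)" using L by (simp add: abs_mult)
      also have "\<dots> \<le> C * exp (- D * v)" using C(1) b by (intro mult_right_mono) auto
      finally show ?thesis .
    qed
    show "c * min (t\<^sup>2) (t powr - \<kappa>) \<le> 1 - Re (charf t)" if "0 < t" for t
      using dioph[OF that] by (simp only: one_minus_Re_charf)
  qed (use D_pos c \<kappa> in auto)
qed

text \<open>The main term arises from \<open>\<Sum>\<^sub>j w\<^sub>j p\<^sub>j / (D mean) = 1/D\<close>.\<close>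

lemma counting_function_error:
  assumes x: "0 < x" "w N \<le> ln x"
  shows "counting_function N (self_similar_weight w) x - x powr D / D
       = x powr D * (\<Sum>j=1..N. w j * exp (- w j * D) * count_error (ln x - w j))"
proof -
  have xD: "x powr D = exp (D * ln x)" using x by (simp add: powr_def)
  have "w j * real (word_count N w (ln x - w j)) =
      x powr D * (w j * exp (- w j * D) * count_error (ln x - w j)) + x powr D * (exp (- w j * D) * w j) / (D * mean)"
    if j: "j \<in> {1..N}" for j
  proof -
    have "0 \<le> ln x - w j" using w_le_last[OF j] x by simp
    then have ce: "count_error (ln x - w j) = tilted_count (ln x - w j) - 1 / (D * mean)" by (simp add: count_error_def)
    have "exp (D * ln x) * exp (- w j * D) * exp (- D * (ln x - w j)) = 1"
      unfolding exp_add[symmetric] by (simp add: algebra_simps)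
    then have "x powr D * exp (- w j * D) * tilted_count (ln x - w j) = real (word_count N w (ln x - w j))"
      unfolding tilted_count_def xD by (simp add: mult.assoc[symmetric])
    moreover have "X * (V * E * (A - 1 / M)) + X * (E * V) / M = V * (X * E * A)" for X V E A M :: real
      by (simp add: algebra_simps)
    ultimately show ?thesis unfolding ce by (simp only:)
  qed
  then have "counting_function N (self_similar_weight w) x
      = (\<Sum>j=1..N. x powr D * (w j * exp (- w j * D) * count_error (ln x - w j)) + x powr D * (exp (- w j * D) * w j) / (D * mean))"
    unfolding counting_function_eq_word_count[OF flow] by (intro sum.cong refl) simp
  also have "\<dots> = x powr D * (\<Sum>j=1..N. w j * exp (- w j * D) * count_error (ln x - w j)) + x powr D * mean / (D * mean)"
    unfolding mean_def by (simp only: sum.distrib sum_distrib_left sum_divide_distrib)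
  also have "x powr D * mean / (D * mean) = x powr D / D" using mean_pos by simp
  finally show ?thesis by simp
qed

lemma counting_function_bigo:
  assumes "0 < \<theta>" "count_error \<in> O(\<lambda>y. (ln y / y) powr \<theta>)"
  shows "(\<lambda>x. counting_function N (self_similar_weight w) x - x powr D / D)
    \<in> O(\<lambda>x. x powr D * (ln (ln x) / ln x) powr \<theta>)"
proof -
  have "eventually (\<lambda>x. counting_function N (self_similar_weight w) x - x powr D / D
      = x powr D * (\<Sum>j=1..N. w j * exp (- w j * D) * count_error (ln x - w j))) at_top"
    using eventually_ge_at_top[of "exp (w N)"]
  proof eventually_elim
    case (elim x)
    have "0 < x" using elim exp_gt_zero[of "w N"] by linarith
    then show ?case using elim by (intro counting_function_error) (auto simp: ln_ge_iff)
  qed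
  moreover have "(\<lambda>x. x powr D * (\<Sum>j=1..N. w j * exp (- w j * D) * count_error (ln x - w j)))
      \<in> O(\<lambda>x. x powr D * (ln (ln x) / ln x) powr \<theta>)"
  proof (rule landau_o.big.mult_left, rule big_sum_in_bigo)
    fix j assume "j \<in> {1..N}"
    have "(\<lambda>x. count_error (ln x - w j)) \<in> O(\<lambda>x. (ln (ln x) / ln x) powr \<theta>)"
      by (rule bigo_shifted_log_ratio[OF assms(2,1)])
    then show "(\<lambda>x. w j * exp (- w j * D) * count_error (ln x - w j)) \<in> O(\<lambda>x. (ln (ln x) / ln x) powr \<theta>)"
      using self_similar_flow_pos(2)[OF flow \<open>j \<in> {1..N}\<close>] by (subst landau_o.big.cmult_in_iff) auto
  qed
  ultimately show ?thesis by (simp only: landau_o.big.in_cong)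
qed

end

lemma prime_orbit_theorem_polynomially_approximable:
  assumes flow: "self_similar_flow N w" and poly: "polynomially_approximable N w l"
  shows "(\<lambda>x. counting_function N (self_similar_weight w) x
                  - x powr flow_dimension N w / flow_dimension N w)
             \<in> O(\<lambda>x. x powr flow_dimension N w
                       * (ln (ln x) / ln x) powr ((real N - 1) / (4 * l * (real N - 1) + 4)))"
proof -
  define D where "D = flow_dimension N w"
  have D: "(\<Sum>j=1..N. exp (- w j * D)) = 1"
    unfolding D_def flow_dimension_def by (rule theI'[OF flow_dimension_ex1(1)[OF flow]])
  have N: "N \<ge> 2" using flow by (simp add: self_similar_flow_def)
  define \<tau> where "\<tau> = l + 1 / (real N - 1)"
  note l = polynomially_approximable_bound[OF flow poly]
  have \<tau>: "0 < \<tau>" using l(1) N by (simp add: \<tau>_def add_nonneg_pos)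
  obtain C where C: "0 < C" "\<And>(q::int) m. 1 \<le> q \<Longrightarrow>
      \<exists>j\<in>{1..N}. C * of_int q powr - \<tau> \<le> \<bar>of_int q * w j - of_int (m j) * w 1\<bar>"
    using l(2) unfolding \<tau>_def by blast
  obtain c where c: "0 < c" and lower: "\<And>t. 0 < t \<Longrightarrow> c * min (t\<^sup>2) (t powr - (2 * \<tau>))
      \<le> (\<Sum>j=1..N. exp (- w j * D) * (1 - cos (t * w j)))"
    using cosine_sum_lower_bound[OF flow _ C(1) \<tau> C(2), of "\<lambda>j. exp (- w j * D)"] by auto
  have "(real N - 1) / (4 * l * (real N - 1) + 4) = 1 / (2 * (2 * \<tau>))"
    using N by (simp add: \<tau>_def field_simps)
  then show ?thesis
    using counting_function_bigo[OF flow D, of "1 / (2 * (2 * \<tau>))"]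
      count_error_bigo[OF flow D c, of "2 * \<tau>"] \<tau> lower
    unfolding D_def by simp
qed

theorem theorem6p14:
  fixes N :: nat and w :: "nat \<Rightarrow> real"
  assumes "self_similar_flow N w" and "nonlattice N w"
  shows "(badly_approximable N w \<longrightarrow>
           (\<lambda>x. counting_function N (self_similar_weight w) x
                  - x powr flow_dimension N w / flow_dimension N w)
             \<in> O(\<lambda>x. x powr flow_dimension N w * (ln (ln x) / ln x) powr ((real N - 1) / 4)))
       \<and> (\<forall>l :: real. polynomially_approximable N w l \<longrightarrow>
           (\<lambda>x. counting_function N (self_similar_weight w) x
                  - x powr flow_dimension N w / flow_dimension N w)
             \<in> O(\<lambda>x. x powr flow_dimension N w
                       * (ln (ln x) / ln x) powr ((real N - 1) / (4 * l * (real N - 1) + 4))))"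
  using prime_orbit_theorem_polynomially_approximable[OF assms(1)]
    badly_approximable_imp_polynomially[OF assms(1)] by fastforce

end
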